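(* If $\mathcal{V}\subseteq\mathcal{B}(H)$ is an approximately $H$-injective masa-bimodule and $\mathcal{U}\subseteq\mathcal{B}(H)$ is a hyperreflexive masa-bimodule, then the algebraic sum $\mathcal{U}+\mathcal{V}$ is hyperreflexive and $k(\mathcal{U}+\mathcal{V})\leq k(\mathcal{U})\,\lambda_H(\mathcal{V})$.
   Context: $H$ is a separable Hilbert space, $\mathcal{B}(H)$ is the space of bounded linear operators on $H$ with the operator norm, and $\mathcal{D}\subseteq\mathcal{B}(H)$ is a fixed maximal abelian selfadjoint algebra (masa). A masa-bimodule ($\mathcal{D}$-bimodule) is a weak* closed subspace $\mathcal{X}\subseteq\mathcal{B}(H)$ with $\mathcal{D}\mathcal{X}\mathcal{D}\subseteq\mathcal{X}$. For a subspace $\mathcal{X}\subseteq\mathcal{B}(H)$ and $T\in\mathcal{B}(H)$, put $d(T,\mathcal{X})=\inf_{X\in\mathcal{X}}\|T-X\|$ and $\alpha(T,\mathcal{X})=\sup\{\inf_{X\in\mathcal{X}}\|T\xi-X\xi\| : \xi\in H,\ \|\xi\|=1\}$. A weak* closed subspace $\mathcal{X}$ is hyperreflexive if there is $k>0$ with $d(T,\mathcal{X})\leq k\,\alpha(T,\mathcal{X})$ for all $T\in\mathcal{B}(H)$; the least (infimal) such $k$ is denoted $k(\mathcal{X})$. A Schur idempotent is a weak* continuous $\mathcal{D}$-bimodule (linear) map $\Phi$ on $\mathcal{B}(H)$ with $\Phi\circ\Phi=\Phi$; $\|\Phi\|$ is its norm as a linear map on $\mathcal{B}(H)$. Put $\Phi^\perp=\mathrm{id}-\Phi$,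 let $\operatorname{Ran}\Phi$ be the range of $\Phi$, and write $\Phi\leq\Psi$ if $\Phi\Psi=\Phi$. $\mathfrak{H}$ is the set of Schur idempotents $\Phi$ for which there is $\lambda>0$ with $\|\Phi^\perp(T)\|\leq\lambda\,\alpha(T,\operatorname{Ran}\Phi)$ for all $T\in\mathcal{B}(H)$; the least (infimal) such $\lambda$ is denoted $\lambda(\Phi)$. A sequence $(\Phi_n)_{n\in\mathbb{N}}$ of Schur idempotents with $\sup_n\|\Phi_n\|<\infty$ decreases to a subspace $\mathcal{V}$ if $\Phi_1\geq\Phi_2\geq\cdots$ and $\mathcal{V}=\bigcap_n\operatorname{Ran}\Phi_n$. A masa-bimodule $\mathcal{V}$ is approximately $H$-injective if there is such a uniformly bounded sequence $(\Phi_n)$ decreasing to $\mathcal{V}$ with $\Phi_n\in\mathfrak{H}$ for each $n$ and $\sup_n\lambda(\Phi_n)<\infty$; the infimum of the possible values of $\sup_n\lambda(\Phi_n)$ over all such sequences is denoted $\lambda_H(\mathcal{V})$. *)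

theory Defs
  imports "HOL-Analysis.Analysis"
begin

class complex_vector = real_vector +
  fixes scaleC :: "complex \<Rightarrow> 'a \<Rightarrow> 'a" (infixr \<open>*\<^sub>C\<close> 75)
  assumes scaleC_add_right: "a *\<^sub>C (x + y) = a *\<^sub>C x + a *\<^sub>C y"
    and scaleC_add_left: "(a + b) *\<^sub>C x = a *\<^sub>C x + b *\<^sub>C x"
    and scaleC_scaleC: "a *\<^sub>C (b *\<^sub>C x) = (a * b) *\<^sub>C x"
    and scaleR_scaleC: "r *\<^sub>R x = complex_of_real r *\<^sub>C x"

lemma scaleC_one: "1 *\<^sub>C x = (x :: 'a::complex_vector)"
  by (metis of_real_1 scaleR_one scaleR_scaleC)

global_interpretation complex_vector: vector_space "scaleC :: complex \<Rightarrow> 'a \<Rightarrow> 'a::complex_vector"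
  defines csubspace = complex_vector.subspace
  by standard (simp_all add: scaleC_add_right scaleC_add_left scaleC_scaleC scaleC_one)

text \<open>
  The complex inner product is linear in the first argument. The norm comes from the class
  \<^class>\<open>real_inner\<close>, whose inner product is required to be the real part of the complex one;
  positive definiteness and \<open>norm x = sqrt (Re (cinner x x))\<close> are inherited from there.
\<close>

class complex_inner = complex_vector + real_inner +
  fixes cinner :: "'a \<Rightarrow> 'a \<Rightarrow> complex"
  assumes cinner_commute: "cinner x y = cnj (cinner y x)"
    and cinner_add_left: "cinner (x + y) z = cinner x z + cinner y z"
    and cinner_scaleC_left: "cinner (c *\<^sub>C x) y = c * cinner x y"
    and inner_eq_Re_cinner: "inner x y = Re (cinner x y)"

class complex_hilbert_space = complex_inner + complete_space

lemma norm_scaleC: "norm (c *\<^sub>C x) = cmod c * norm (x :: 'a::complex_inner)"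
proof -
  have "cinner (c *\<^sub>C x) (c *\<^sub>C x) = c * cnj (c * cinner x x)"
    by (metis cinner_commute cinner_scaleC_left)
  also have "\<dots> = c * cnj c * cinner x x"
    using cinner_commute[of x x] by (simp add: mult_ac)
  also have "\<dots> = of_real ((cmod c)\<^sup>2) * cinner x x"
    by (simp only: complex_norm_square)
  finally have "(norm (c *\<^sub>C x))\<^sup>2 = (cmod c * norm x)\<^sup>2"
    by (simp add: power2_norm_eq_inner inner_eq_Re_cinner power_mult_distrib)
  then show ?thesis
    by (simp add: power2_eq_iff_nonneg)
qed

lemma bounded_linear_scaleC: "bounded_linear (\<lambda>x :: 'a::complex_inner. c *\<^sub>C x)"
proof (rule bounded_linear_intro[where K = "cmod c"])
  show "c *\<^sub>C (r *\<^sub>R x) = r *\<^sub>R (c *\<^sub>C x)" for r and x :: 'a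
    by (simp add: scaleR_scaleC scaleC_scaleC mult.commute)
qed (simp_all add: scaleC_add_right norm_scaleC mult.commute)

instantiation complex :: complex_hilbert_space
begin

definition scaleC_complex :: "complex \<Rightarrow> complex \<Rightarrow> complex" where
  "scaleC_complex c z = c * z"

definition cinner_complex :: "complex \<Rightarrow> complex \<Rightarrow> complex" where
  "cinner_complex x y = x * cnj y"

instance
  by standard
    (simp_all add: scaleC_complex_def cinner_complex_def inner_complex_def algebra_simps
      scaleR_conv_of_real)

end

instantiation blinfun :: (real_normed_vector, complex_inner) complex_vector
begin

lift_definition scaleC_blinfun :: "complex \<Rightarrow> ('a \<Rightarrow>\<^sub>L 'b) \<Rightarrow> ('a \<Rightarrow>\<^sub>L 'b)"
  is "\<lambda>c f x. c *\<^sub>C f x"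
  by (rule bounded_linear_compose[OF bounded_linear_scaleC])

instance
  by standard
    (transfer; simp add: fun_eq_iff scaleC_add_right scaleC_add_left scaleC_scaleC scaleR_scaleC)+

end

text \<open>
  The elements of \<^typ>\<open>'h \<Rightarrow>\<^sub>L 'h\<close> are the bounded \<^emph>\<open>real\<close>-linear maps, so the space of bounded
  operators is the subset of complex-linear ones. Its norm is the operator norm.
\<close>

definition BH :: "('h::complex_hilbert_space \<Rightarrow>\<^sub>L 'h) set" where
  "BH = {T. \<forall>c x. blinfun_apply T (c *\<^sub>C x) = c *\<^sub>C blinfun_apply T x}"

text \<open>
  The functionals in the predual of \<open>BH\<close> (the traces \<open>T \<mapsto> tr (T A)\<close> against trace class
  operators \<open>A\<close>) are the maps \<open>T \<mapsto> (\<Sum>n. \<langle>T \<xi>\<^sub>n, \<eta>\<^sub>n\<rangle>)\<close> with square-summable sequences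
  of vectors; the series converges absolutely. The weak* (or ultraweak) topology on \<open>BH\<close> is the
  coarsest one making all of them continuous.
\<close>

definition predual_functionals :: "(('h::complex_hilbert_space \<Rightarrow>\<^sub>L 'h) \<Rightarrow> complex) set" where
  "predual_functionals =
    {\<lambda>T. \<Sum>n. cinner (blinfun_apply T (\<xi> n)) (\<eta> n) | \<xi> \<eta> :: nat \<Rightarrow> 'h.
      summable (\<lambda>n. (norm (\<xi> n))\<^sup>2) \<and> summable (\<lambda>n. (norm (\<eta> n))\<^sup>2)}"

definition weak_star_topology :: "('h::complex_hilbert_space \<Rightarrow>\<^sub>L 'h) topology" where
  "weak_star_topology =
    topology_generated_by {{T \<in> BH. \<phi> T \<in> G} | \<phi> G. \<phi> \<in> predual_functionals \<and> open G}"

definition weak_star_closed_subspace :: "('h::complex_hilbert_space \<Rightarrow>\<^sub>L 'h) set \<Rightarrow> bool" where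
  "weak_star_closed_subspace X \<longleftrightarrow> X \<subseteq> BH \<and> csubspace X \<and> closedin weak_star_topology X"

definition is_adjoint ::
    "('h::complex_hilbert_space \<Rightarrow>\<^sub>L 'h) \<Rightarrow> ('h \<Rightarrow>\<^sub>L 'h) \<Rightarrow> bool" where
  "is_adjoint S T \<longleftrightarrow>
    (\<forall>x y. cinner (blinfun_apply S x) y = cinner x (blinfun_apply T y))"

definition abelian_selfadjoint_algebra :: "('h::complex_hilbert_space \<Rightarrow>\<^sub>L 'h) set \<Rightarrow> bool" where
  "abelian_selfadjoint_algebra D \<longleftrightarrow>
    D \<subseteq> BH \<and> csubspace D \<and>
    (\<forall>A\<in>D. \<forall>B\<in>D. A o\<^sub>L B \<in> D) \<and>
    (\<forall>A\<in>D. \<forall>B\<in>D. A o\<^sub>L B = B o\<^sub>L A) \<and>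
    (\<forall>A\<in>D. \<exists>S\<in>D. is_adjoint S A)"

definition masa :: "('h::complex_hilbert_space \<Rightarrow>\<^sub>L 'h) set \<Rightarrow> bool" where
  "masa D \<longleftrightarrow> abelian_selfadjoint_algebra D \<and>
    (\<forall>E. abelian_selfadjoint_algebra E \<longrightarrow> D \<subseteq> E \<longrightarrow> E = D)"

definition masa_bimodule ::
    "('h::complex_hilbert_space \<Rightarrow>\<^sub>L 'h) set \<Rightarrow> ('h \<Rightarrow>\<^sub>L 'h) set \<Rightarrow> bool" where
  "masa_bimodule D X \<longleftrightarrow> weak_star_closed_subspace X \<and>
    (\<forall>A\<in>D. \<forall>T\<in>X. \<forall>B\<in>D. A o\<^sub>L T o\<^sub>L B \<in> X)"

definition op_dist ::
    "('h::complex_hilbert_space \<Rightarrow>\<^sub>L 'h) \<Rightarrow> ('h \<Rightarrow>\<^sub>L 'h) set \<Rightarrow> real" where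
  "op_dist T X = (INF S\<in>X. norm (T - S))"

text \<open>
  The inserted \<open>0\<close> only matters if the Hilbert space is zero, so that there are no unit vectors:
  the supremum of the empty set of nonnegative quantities is then \<open>0\<close>.
\<close>

definition arveson_dist ::
    "('h::complex_hilbert_space \<Rightarrow>\<^sub>L 'h) \<Rightarrow> ('h \<Rightarrow>\<^sub>L 'h) set \<Rightarrow> real" where
  "arveson_dist T X =
    Sup (insert 0 ((\<lambda>\<xi>. INF S\<in>X. norm (blinfun_apply T \<xi> - blinfun_apply S \<xi>)) ` {\<xi>. norm \<xi> = 1}))"

definition hyperreflexivity_bounds :: "('h::complex_hilbert_space \<Rightarrow>\<^sub>L 'h) set \<Rightarrow> real set" where
  "hyperreflexivity_bounds X = {k. k > 0 \<and> (\<forall>T\<in>BH. op_dist T X \<le> k * arveson_dist T X)}"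

definition hyperreflexive :: "('h::complex_hilbert_space \<Rightarrow>\<^sub>L 'h) set \<Rightarrow> bool" where
  "hyperreflexive X \<longleftrightarrow> weak_star_closed_subspace X \<and> hyperreflexivity_bounds X \<noteq> {}"

definition hyperreflexivity_constant :: "('h::complex_hilbert_space \<Rightarrow>\<^sub>L 'h) set \<Rightarrow> real" where
  "hyperreflexivity_constant X = Inf (hyperreflexivity_bounds X)"

text \<open>
  A map on the bounded operators is a function on the whole type \<^typ>\<open>'h \<Rightarrow>\<^sub>L 'h\<close>, but only its
  values on \<open>BH\<close> are ever used.
\<close>

definition schur_idempotent ::
    "('h::complex_hilbert_space \<Rightarrow>\<^sub>L 'h) set \<Rightarrow> (('h \<Rightarrow>\<^sub>L 'h) \<Rightarrow> ('h \<Rightarrow>\<^sub>L 'h)) \<Rightarrow> bool" where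
  "schur_idempotent D \<Phi> \<longleftrightarrow>
    (\<forall>T\<in>BH. \<Phi> T \<in> BH) \<and>
    (\<forall>S\<in>BH. \<forall>T\<in>BH. \<Phi> (S + T) = \<Phi> S + \<Phi> T) \<and>
    (\<forall>c. \<forall>T\<in>BH. \<Phi> (c *\<^sub>C T) = c *\<^sub>C \<Phi> T) \<and>
    (\<forall>A\<in>D. \<forall>T\<in>BH. \<forall>B\<in>D. \<Phi> (A o\<^sub>L T o\<^sub>L B) = A o\<^sub>L \<Phi> T o\<^sub>L B) \<and>
    continuous_map weak_star_topology weak_star_topology \<Phi> \<and>
    (\<forall>T\<in>BH. \<Phi> (\<Phi> T) = \<Phi> T)"

definition map_norm ::
    "(('h::complex_hilbert_space \<Rightarrow>\<^sub>L 'h) \<Rightarrow> ('h \<Rightarrow>\<^sub>L 'h)) \<Rightarrow> ennreal" where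
  "map_norm \<Phi> = (SUP T\<in>{T \<in> BH. norm T \<le> 1}. ennreal (norm (\<Phi> T)))"

definition Ran ::
    "(('h::complex_hilbert_space \<Rightarrow>\<^sub>L 'h) \<Rightarrow> ('h \<Rightarrow>\<^sub>L 'h)) \<Rightarrow> ('h \<Rightarrow>\<^sub>L 'h) set" where
  "Ran \<Phi> = \<Phi> ` BH"

definition map_perp ::
    "(('h::complex_hilbert_space \<Rightarrow>\<^sub>L 'h) \<Rightarrow> ('h \<Rightarrow>\<^sub>L 'h)) \<Rightarrow> ('h \<Rightarrow>\<^sub>L 'h) \<Rightarrow> ('h \<Rightarrow>\<^sub>L 'h)" where
  "map_perp \<Phi> T = T - \<Phi> T"

definition schur_le ::
    "(('h::complex_hilbert_space \<Rightarrow>\<^sub>L 'h) \<Rightarrow> ('h \<Rightarrow>\<^sub>L 'h)) \<Rightarrow>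
      (('h \<Rightarrow>\<^sub>L 'h) \<Rightarrow> ('h \<Rightarrow>\<^sub>L 'h)) \<Rightarrow> bool" where
  "schur_le \<Phi> \<Psi> \<longleftrightarrow> (\<forall>T\<in>BH. \<Phi> (\<Psi> T) = \<Phi> T)"

definition lambda_bounds ::
    "(('h::complex_hilbert_space \<Rightarrow>\<^sub>L 'h) \<Rightarrow> ('h \<Rightarrow>\<^sub>L 'h)) \<Rightarrow> real set" where
  "lambda_bounds \<Phi> =
    {l. l > 0 \<and> (\<forall>T\<in>BH. norm (map_perp \<Phi> T) \<le> l * arveson_dist T (Ran \<Phi>))}"

definition schur_H ::
    "('h::complex_hilbert_space \<Rightarrow>\<^sub>L 'h) set \<Rightarrow> (('h \<Rightarrow>\<^sub>L 'h) \<Rightarrow> ('h \<Rightarrow>\<^sub>L 'h)) set" where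
  "schur_H D = {\<Phi>. schur_idempotent D \<Phi> \<and> lambda_bounds \<Phi> \<noteq> {}}"

definition schur_lambda ::
    "(('h::complex_hilbert_space \<Rightarrow>\<^sub>L 'h) \<Rightarrow> ('h \<Rightarrow>\<^sub>L 'h)) \<Rightarrow> real" where
  "schur_lambda \<Phi> = Inf (lambda_bounds \<Phi>)"

definition decreases_to ::
    "('h::complex_hilbert_space \<Rightarrow>\<^sub>L 'h) set \<Rightarrow> (nat \<Rightarrow> ('h \<Rightarrow>\<^sub>L 'h) \<Rightarrow> ('h \<Rightarrow>\<^sub>L 'h)) \<Rightarrow>
      ('h \<Rightarrow>\<^sub>L 'h) set \<Rightarrow> bool" where
  "decreases_to D \<Phi> V \<longleftrightarrow>
    (\<forall>n. schur_idempotent D (\<Phi> n)) \<and>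
    (SUP n. map_norm (\<Phi> n)) < \<infinity> \<and>
    (\<forall>n. schur_le (\<Phi> (Suc n)) (\<Phi> n)) \<and>
    V = (\<Inter>n. Ran (\<Phi> n))"

definition H_injective_sequences ::
    "('h::complex_hilbert_space \<Rightarrow>\<^sub>L 'h) set \<Rightarrow> ('h \<Rightarrow>\<^sub>L 'h) set \<Rightarrow>
      (nat \<Rightarrow> ('h \<Rightarrow>\<^sub>L 'h) \<Rightarrow> ('h \<Rightarrow>\<^sub>L 'h)) set" where
  "H_injective_sequences D V =
    {\<Phi>. decreases_to D \<Phi> V \<and> (\<forall>n. \<Phi> n \<in> schur_H D) \<and>
      bdd_above (range (\<lambda>n. schur_lambda (\<Phi> n)))}"

definition approx_H_injective ::
    "('h::complex_hilbert_space \<Rightarrow>\<^sub>L 'h) set \<Rightarrow> ('h \<Rightarrow>\<^sub>L 'h) set \<Rightarrow> bool" where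
  "approx_H_injective D V \<longleftrightarrow> masa_bimodule D V \<and> H_injective_sequences D V \<noteq> {}"

definition lambda_H ::
    "('h::complex_hilbert_space \<Rightarrow>\<^sub>L 'h) set \<Rightarrow> ('h \<Rightarrow>\<^sub>L 'h) set \<Rightarrow> real" where
  "lambda_H D V = (INF \<Phi>\<in>H_injective_sequences D V. SUP n. schur_lambda (\<Phi> n))"

end

theory Submission
  imports Defs "HOL-Complex_Analysis.Great_Picard"
begin

text \<open>
  For a Schur idempotent \<open>\<Phi>\<close> with finite \<open>\<lambda>(\<Phi>)\<close> and a bimodule \<open>X\<close> one has
  \<open>\<alpha>(\<Phi>\<^sup>\<bottom>(T), X) \<le> \<lambda>(\<Phi>) \<alpha>(T, X + Ran \<Phi>)\<close>: cutting \<open>T\<close> down by two projections of the masa that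
  annihilate \<open>X\<close> replaces \<open>\<alpha>\<close> on the left by a norm. When \<open>X\<close> is reflexive, taking \<open>T \<in> X\<close> shows
  that \<open>\<Phi>\<close> leaves \<open>X\<close> invariant, so no structure theory of Schur maps is needed. Hence
  \<open>U + V\<close> is the intersection of the weak* closed spaces \<open>{T. \<Phi>\<^sub>n\<^sup>\<bottom>(T) \<in> U}\<close>, and
  \<open>d(\<Phi>\<^sub>n\<^sup>\<bottom>(T), U) \<le> k(U) \<lambda>(\<Phi>\<^sub>n) \<alpha>(T, U + V)\<close>. A weak* limit of \<open>\<Phi>\<^sub>n(T)\<close> and of almost best
  approximants of \<open>\<Phi>\<^sub>n\<^sup>\<bottom>(T)\<close> in \<open>U\<close> decomposes \<open>T\<close> up to an error of that size.
\<close>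

subsection \<open>Orthogonal projections and the masa\<close>

text \<open>A variational proof: the representing vector is the minimiser of
  \<open>norm y ^ 2 - 2 * f y\<close> on \<open>M\<close>. With \<open>f = inner x\<close> it yields
  the orthogonal projection onto \<open>M\<close>; with \<open>M = UNIV\<close> it later turns a
  limit of bounded forms into an operator.\<close>

lemma Riesz_closed_subspace:
  fixes f :: "'a::{real_inner,complete_space} \<Rightarrow> real"
  assumes M: "subspace M" "closed M"
    and f_add: "\<And>x y. x \<in> M \<Longrightarrow> y \<in> M \<Longrightarrow> f (x + y) = f x + f y"
    and f_scale: "\<And>c x. x \<in> M \<Longrightarrow> f (c *\<^sub>R x) = c * f x"
    and f_bound: "\<And>x. x \<in> M \<Longrightarrow> \<bar>f x\<bar> \<le> K * norm x"
  obtains p where "p \<in> M" "\<And>y. y \<in> M \<Longrightarrow> inner p y = f y"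
proof -
  \<comment> \<open>If \<open>p\<close> represents \<open>f\<close> on \<open>M\<close>, then
    \<open>J y\<close> is the squared distance from \<open>y\<close> to \<open>p\<close> minus the
    squared norm of \<open>p\<close>, so minimising \<open>J\<close> finds \<open>p\<close>.\<close>
  define J where "J y = (norm y)\<^sup>2 - 2 * f y" for y
  define m where "m = Inf (J ` M)"
  have J_ge: "- K\<^sup>2 \<le> J y" if "y \<in> M" for y
  proof -
    have "0 \<le> (norm y - K)\<^sup>2" by simp
    also have "\<dots> = (norm y)\<^sup>2 - 2 * (K * norm y) + K\<^sup>2"
      by (simp add: power2_diff)
    finally show ?thesis
      using f_bound[OF that] unfolding J_def by linarith
  qed
  have bdd: "bdd_below (J ` M)"
    using J_ge by (intro bdd_belowI2)
  have m_le: "m \<le> J y" if "y \<in> M" for y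
    unfolding m_def using bdd that by (rule cINF_lower)
  have ne: "J ` M \<noteq> {}"
    using subspace_0[OF M(1)] by auto
  have "\<exists>y\<in>M. J y < m + 1 / real (Suc n)" for n
    using cInf_lessD[OF ne, of "m + 1 / real (Suc n)"] unfolding m_def by auto
  then obtain y where y: "\<And>n. y n \<in> M" "\<And>n. J (y n) < m + 1 / real (Suc n)"
    by metis
  \<comment> \<open>The terms in \<open>f\<close> cancel because \<open>f\<close> is additive at the
    midpoint; what is left is the parallelogram law.\<close>
  have parallelogram: "(norm (a - b))\<^sup>2 = 2 * (J a + J b - 2 * J ((1/2) *\<^sub>R (a + b)))"
    if "a \<in> M" "b \<in> M" for a b
  proof -
    have "f ((1/2) *\<^sub>R (a + b)) = (f a + f b) / 2"
      using that f_scale[of "a + b" "1/2"] f_add[of a b] subspace_add[OF M(1)] by simp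
    then show ?thesis
      unfolding J_def power2_norm_eq_inner
      by (simp add: inner_add_left inner_add_right inner_diff_left inner_diff_right
          inner_commute field_simps)
  qed
  \<comment> \<open>The midpoint stays in \<open>M\<close>, where \<open>J\<close> is at least
    \<open>m\<close>, so the squared distance is at most twice the sum of the two excesses over
    \<open>m\<close>.\<close>
  have dist_y: "(norm (y i - y j))\<^sup>2 \<le> 2 / real (Suc i) + 2 / real (Suc j)" for i j
  proof -
    have "(1/2) *\<^sub>R (y i + y j) \<in> M"
      using y(1) M(1) by (intro subspace_scale subspace_add)
    from m_le[OF this] show ?thesis
      unfolding parallelogram[OF y(1) y(1)] using y(2)[of i] y(2)[of j] by simp
  qed
  have "Cauchy y"
  proof (rule metric_CauchyI)
    fix e :: real assume "0 < e"
    then obtain N where N: "inverse (real (Suc N)) < e\<^sup>2 / 4"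
      using reals_Archimedean[of "e\<^sup>2 / 4"] by auto
    have "dist (y i) (y j) < e" if "N \<le> i" "N \<le> j" for i j
    proof -
      have "2 / real (Suc i) \<le> 2 / real (Suc N)" "2 / real (Suc j) \<le> 2 / real (Suc N)"
        using that by (auto intro!: divide_left_mono)
      then have "(norm (y i - y j))\<^sup>2 < e\<^sup>2"
        using dist_y[of i j] N by (simp add: inverse_eq_divide)
      then show ?thesis
        using \<open>0 < e\<close> by (simp add: dist_norm power_less_imp_less_base)
    qed
    then show "\<exists>N. \<forall>i\<ge>N. \<forall>j\<ge>N. dist (y i) (y j) < e"
      by blast
  qed
  then obtain p where p: "y \<longlonglongrightarrow> p"
    using Cauchy_convergent convergentD by blast
  have pM: "p \<in> M"
    using closed_sequentially[OF M(2) y(1) p] .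
  have f_y: "(\<lambda>n. f (y n)) \<longlonglongrightarrow> f p"
  proof (rule Lim_null[THEN iffD2], rule Lim_null_comparison)
    have "f (y n) - f p = f (y n - p)" for n
      using f_add[of "y n - p" p] y(1) pM subspace_diff[OF M(1)] by simp
    then show "\<forall>\<^sub>F n in sequentially. norm (f (y n) - f p) \<le> K * norm (y n - p)"
      using f_bound y(1) pM subspace_diff[OF M(1)] by simp
    show "(\<lambda>n. K * norm (y n - p)) \<longlonglongrightarrow> 0"
      using tendsto_mult_right_zero[OF tendsto_norm_zero[OF Lim_null[THEN iffD1, OF p]]] .
  qed
  have "(\<lambda>n. J (y n)) \<longlonglongrightarrow> J p"
    unfolding J_def by (intro tendsto_intros p f_y)
  moreover have "(\<lambda>n. m + 1 / real (Suc n)) \<longlonglongrightarrow> m + 0"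
    using LIMSEQ_inverse_real_of_nat by (intro tendsto_intros) (simp add: inverse_eq_divide)
  ultimately have Jp: "J p \<le> m"
    using LIMSEQ_le[of "\<lambda>n. J (y n)" "J p" "\<lambda>n. m + 1 / real (Suc n)"] y(2)
    by (auto intro: less_imp_le)
  have "inner p z = f z" if z: "z \<in> M" for z
  proof (cases "z = 0")
    case True
    then show ?thesis using f_scale[OF z, of 0] by simp
  next
    case False
    define d where "d = inner p z - f z"
    \<comment> \<open>This \<open>t\<close> minimises the quadratic
      \<open>2 * t * d + t^2 * inner z z\<close>, whose minimum is negative unless
      \<open>d = 0\<close>.\<close>
    define t where "t = - d / inner z z"
    have tz: "t *\<^sub>R z \<in> M"
      using M(1) z by (rule subspace_scale)
    have "J p \<le> J (p + t *\<^sub>R z)"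
      using Jp m_le[OF subspace_add[OF M(1) pM tz]] by simp
    also have "\<dots> = J p + 2 * t * d + t\<^sup>2 * inner z z"
      unfolding J_def f_add[OF pM tz] f_scale[OF z] power2_norm_eq_inner d_def
      by (simp add: inner_add_left inner_add_right inner_commute power2_eq_square algebra_simps)
    also have "\<dots> = J p - d\<^sup>2 / inner z z"
      using False unfolding t_def by (simp add: power2_eq_square field_simps)
    finally have "d\<^sup>2 / inner z z \<le> 0" by simp
    moreover have "inner z z > 0"
      using False by simp
    ultimately have "d\<^sup>2 \<le> 0"
      by (simp add: divide_le_0_iff)
    then show ?thesis unfolding d_def by simp
  qed
  with pM that show thesis by blast
qed

section \<open>Complex inner products and complex-linear operators\<close>

lemma cinner_scaleC_right: "cinner x (c *\<^sub>C y) = cnj c * cinner x (y :: 'a::complex_inner)"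
  by (metis cinner_commute cinner_scaleC_left complex_cnj_cnj complex_cnj_mult)

lemma cinner_add_right: "cinner x (y + z) = cinner x y + cinner x (z :: 'a::complex_inner)"
  by (metis cinner_commute cinner_add_left complex_cnj_add)

text \<open>Conjugate linearity in the second argument turns the imaginary part into a real part.
  Limits and identities can thus be proved for the real inner product and transferred to the complex
  one.\<close>

lemma cinner_eq_inner:
  "cinner x y = Complex (inner x y) (inner x (\<i> *\<^sub>C (y :: 'a::complex_inner)))"
  by (simp add: complex_eq_iff inner_eq_Re_cinner cinner_scaleC_right)

lemma inner_scaleC_left: "inner (c *\<^sub>C x) y = inner x (cnj c *\<^sub>C (y :: 'a::complex_inner))"
  by (simp add: inner_eq_Re_cinner cinner_scaleC_left cinner_scaleC_right)

text \<open>The factor 2 comes from bounding real and imaginary parts separately; it is enough for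
  absolute convergence.\<close>

lemma cmod_cinner_le: "cmod (cinner x y) \<le> 2 * (norm x * norm (y :: 'a::complex_inner))"
proof -
  have "cmod (cinner x y) \<le> \<bar>inner x y\<bar> + \<bar>inner x (\<i> *\<^sub>C y)\<bar>"
    using cmod_le[of "cinner x y"] by (simp add: cinner_eq_inner)
  also have "\<dots> \<le> norm x * norm y + norm x * norm (\<i> *\<^sub>C y)"
    by (intro add_mono Cauchy_Schwarz_ineq2)
  finally show ?thesis by (simp add: norm_scaleC)
qed

lemma csubspace_imp_subspace: "csubspace M \<Longrightarrow> subspace M"
  unfolding subspace_def complex_vector.subspace_def by (simp add: scaleR_scaleC)

lemma csubspace_closure:
  fixes M :: "'a::complex_inner set"
  assumes "csubspace M"
  shows "csubspace (closure M)"
  unfolding complex_vector.subspace_def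
proof (intro conjI allI ballI)
  show "0 \<in> closure M"
    using complex_vector.subspace_0[OF assms] closure_subset by blast
next
  fix x y assume "x \<in> closure M" "y \<in> closure M"
  then obtain u v where "\<And>n::nat. u n \<in> M" "u \<longlonglongrightarrow> x" "\<And>n::nat. v n \<in> M" "v \<longlonglongrightarrow> y"
    unfolding closure_sequential by blast
  then show "x + y \<in> closure M"
    unfolding closure_sequential
    by (intro exI[of _ "\<lambda>n. u n + v n"])
       (auto intro: tendsto_add complex_vector.subspace_add[OF assms])
next
  fix c and x assume "x \<in> closure M"
  moreover have "continuous_on (closure M) (\<lambda>x. c *\<^sub>C x)"
    by (rule linear_continuous_on[OF bounded_linear_scaleC])
  moreover have "(\<lambda>x. c *\<^sub>C x) ` M \<subseteq> closure M"
    using complex_vector.subspace_scale[OF assms] closure_subset by blast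
  ultimately show "c *\<^sub>C x \<in> closure M"
    using image_closure_subset[of M "\<lambda>x. c *\<^sub>C x" "closure M"] by auto
qed

lemma BH_scaleC: "T \<in> BH \<Longrightarrow> blinfun_apply T (c *\<^sub>C x) = c *\<^sub>C blinfun_apply T x"
  by (simp add: BH_def)

lemma csubspace_BH: "csubspace BH"
  by (simp add: complex_vector.subspace_def BH_def scaleC_blinfun.rep_eq blinfun.add_left
      scaleC_add_right scaleC_scaleC mult.commute)

lemma BH_compose: "S \<in> BH \<Longrightarrow> T \<in> BH \<Longrightarrow> S o\<^sub>L T \<in> BH"
  by (simp add: BH_def)

lemma BH_id: "id_blinfun \<in> BH"
  by (simp add: BH_def)

lemmas BH_add = complex_vector.subspace_add[OF csubspace_BH]
  and BH_diff = complex_vector.subspace_diff[OF csubspace_BH]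

text \<open>Orthogonality uses the real inner product. For a complex subspace \<open>M\<close> this
  is complex orthogonality, since \<open>M\<close> is closed under multiplication by
  \<open>\<i>\<close>.\<close>

definition orthogonal_projection ::
    "('h::complex_hilbert_space) set \<Rightarrow> ('h \<Rightarrow>\<^sub>L 'h) \<Rightarrow> bool" where
  "orthogonal_projection M P \<longleftrightarrow> P \<in> BH \<and>
    (\<forall>x. blinfun_apply P x \<in> M) \<and> (\<forall>x. \<forall>y\<in>M. inner (x - blinfun_apply P x) y = 0)"

lemma orthogonal_decomposition_unique:
  fixes p q x :: "'a::real_inner"
  assumes "subspace M" "p \<in> M" "q \<in> M"
    and "\<And>y. y \<in> M \<Longrightarrow> inner (x - p) y = 0" and "\<And>y. y \<in> M \<Longrightarrow> inner (x - q) y = 0"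
  shows "p = q"
proof -
  have "q - p \<in> M"
    using assms(1-3) by (simp add: subspace_diff)
  then have "inner (x - p) (q - p) = 0" "inner (x - q) (q - p) = 0"
    using assms(4,5) by auto
  then have "inner (q - p) (q - p) = 0"
    by (simp add: inner_diff_left)
  then show ?thesis by simp
qed

text \<open>\<open>P x\<close> represents the functional \<open>inner x\<close> on \<open>M\<close>.
  Uniqueness of the representing vector makes \<open>P\<close> additive and complex-linear.\<close>

lemma orthogonal_projection_exists:
  fixes M :: "'h::complex_hilbert_space set"
  assumes M: "csubspace M" "closed M"
  obtains P where "orthogonal_projection M P"
proof -
  note sub = csubspace_imp_subspace[OF M(1)]
  have "\<exists>p\<in>M. \<forall>y\<in>M. inner p y = inner x y" for x
    by (rule Riesz_closed_subspace[OF sub M(2), of "inner x" "norm x"])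
       (auto simp: inner_add_right Cauchy_Schwarz_ineq2)
  then obtain P where P: "\<And>x. P x \<in> M" "\<And>x y. y \<in> M \<Longrightarrow> inner (P x) y = inner x y"
    by metis
  have unique: "P x = p" if "p \<in> M" "\<And>y. y \<in> M \<Longrightarrow> inner p y = inner x y" for x p
    using orthogonal_decomposition_unique[OF sub P(1) that(1), of x x] P(2) that(2)
    by (simp add: inner_diff_left)
  have P_add: "P (x + z) = P x + P z" for x z
    by (rule unique) (simp_all add: subspace_add[OF sub] P inner_add_left)
  have P_scaleC: "P (c *\<^sub>C x) = c *\<^sub>C P x" for c x
    by (rule unique) (simp_all add: complex_vector.subspace_scale[OF M(1)] P inner_scaleC_left)
  have P_norm: "norm (P x) \<le> norm x * 1" for x
  proof -
    have "norm (P x) * norm (P x) = inner x (P x)"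
      using P(2)[OF P(1), of x x] by (simp add: power2_norm_eq_inner[symmetric] power2_eq_square)
    also have "\<dots> \<le> norm x * norm (P x)"
      by (rule norm_cauchy_schwarz)
    finally show ?thesis
      by (metis P(1) mult.right_neutral mult_le_cancel_right norm_ge_zero norm_not_less_zero
          order_le_imp_less_or_eq)
  qed
  have bl: "bounded_linear P"
    by (rule bounded_linear_intro[where K = 1])
       (simp_all only: P_add scaleR_scaleC P_scaleC P_norm)
  have "orthogonal_projection M (Blinfun P)"
    unfolding orthogonal_projection_def BH_def
    by (simp add: bounded_linear_Blinfun_apply[OF bl] P_scaleC P inner_diff_left)
  with that show thesis .
qed

lemma orthogonal_projection_fixes:
  assumes "orthogonal_projection M P" "subspace M" "x \<in> M"
  shows "blinfun_apply P x = x"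
  using orthogonal_decomposition_unique[of M "blinfun_apply P x" x x] assms
  by (auto simp: orthogonal_projection_def)

lemma orthogonal_projection_idem:
  assumes "orthogonal_projection M P" "subspace M"
  shows "P o\<^sub>L P = P"
  using orthogonal_projection_fixes[OF assms] assms(1)
  by (auto simp: orthogonal_projection_def intro!: blinfun_eqI)

lemma orthogonal_projection_self_adjoint:
  assumes P: "orthogonal_projection M P"
  shows "is_adjoint P P"
proof -
  have *: "inner (blinfun_apply P x) y = inner x (blinfun_apply P y)" for x y
  proof -
    have "inner (x - blinfun_apply P x) (blinfun_apply P y) = 0"
      "inner (y - blinfun_apply P y) (blinfun_apply P x) = 0"
      using P by (auto simp: orthogonal_projection_def)
    then show ?thesis
      by (simp add: inner_diff_left inner_commute[of y] inner_commute[of "blinfun_apply P y"])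
  qed
  \<comment> \<open>Complex linearity moves the factor \<open>\<i>\<close> through \<open>P\<close>,
    which upgrades the real identity to the complex one.\<close>
  have "P \<in> BH" using P by (simp add: orthogonal_projection_def)
  then show ?thesis
    by (simp add: is_adjoint_def cinner_eq_inner * BH_scaleC[symmetric])
qed

lemma inner_adjoint:
  assumes "is_adjoint S T"
  shows "inner (blinfun_apply S x) y = inner x (blinfun_apply T y)"
  using assms by (simp add: is_adjoint_def inner_eq_Re_cinner)

text \<open>Split \<open>A x\<close> as \<open>A (P x) + A (x - P x)\<close>: the first summand lies
  in \<open>M\<close>, and the second is orthogonal to \<open>M\<close> because the adjoint
  \<open>S\<close> preserves \<open>M\<close>. Uniqueness of the decomposition identifies
  \<open>A (P x)\<close> with \<open>P (A x)\<close>.\<close>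

lemma orthogonal_projection_commute:
  assumes P: "orthogonal_projection M P" and M: "csubspace M"
    and AS: "is_adjoint S A"
    and inv: "\<And>x. x \<in> M \<Longrightarrow> blinfun_apply A x \<in> M" "\<And>x. x \<in> M \<Longrightarrow> blinfun_apply S x \<in> M"
  shows "A o\<^sub>L P = P o\<^sub>L A"
proof (rule blinfun_eqI)
  fix x
  have PM: "\<And>x. blinfun_apply P x \<in> M" and
    orth: "\<And>x y. y \<in> M \<Longrightarrow> inner (x - blinfun_apply P x) y = 0"
    using P by (auto simp: orthogonal_projection_def)
  have "blinfun_apply A (blinfun_apply P x) = blinfun_apply P (blinfun_apply A x)"
  proof (rule orthogonal_decomposition_unique[OF csubspace_imp_subspace[OF M]])
    fix y assume y: "y \<in> M"
    have "inner (blinfun_apply A x - blinfun_apply A (blinfun_apply P x)) y =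
        inner (x - blinfun_apply P x) (blinfun_apply S y)"
      using inner_adjoint[OF AS, of y "x - blinfun_apply P x"]
      by (simp add: blinfun.diff_right inner_commute)
    then show "inner (blinfun_apply A x - blinfun_apply A (blinfun_apply P x)) y = 0"
      using orth inv(2) y by simp
  qed (simp_all add: PM inv(1) orth)
  then show "blinfun_apply (A o\<^sub>L P) x = blinfun_apply (P o\<^sub>L A) x"
    by simp
qed

section \<open>Projections contained in a masa\<close>

lemma is_adjoint_add: "is_adjoint S A \<Longrightarrow> is_adjoint T B \<Longrightarrow> is_adjoint (S + T) (A + B)"
  by (simp add: is_adjoint_def blinfun.add_left cinner_add_left cinner_add_right)

lemma is_adjoint_compose:
  "is_adjoint S A \<Longrightarrow> is_adjoint T B \<Longrightarrow> is_adjoint (S o\<^sub>L T) (B o\<^sub>L A)"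
  by (simp add: is_adjoint_def)

lemma is_adjoint_scaleC: "is_adjoint S A \<Longrightarrow> is_adjoint (cnj c *\<^sub>C S) (c *\<^sub>C A)"
  by (simp add: is_adjoint_def scaleC_blinfun.rep_eq cinner_scaleC_left cinner_scaleC_right)

lemma scaleC_compose_left: "(c *\<^sub>C S) o\<^sub>L T = c *\<^sub>C (S o\<^sub>L T)"
  by (rule blinfun_eqI) (simp add: scaleC_blinfun.rep_eq)

text \<open>Adjoining \<open>P\<close> to \<open>D\<close> gives a larger abelian selfadjoint
  algebra, which maximality forces to equal \<open>D\<close>.\<close>

lemma masa_contains_commuting_projection:
  fixes D :: "('h::complex_hilbert_space \<Rightarrow>\<^sub>L 'h) set"
  assumes D: "masa D" and P: "P \<in> BH" "P o\<^sub>L P = P" "is_adjoint P P"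
    and comm: "\<And>A. A \<in> D \<Longrightarrow> A o\<^sub>L P = P o\<^sub>L A"
  shows "P \<in> D"
proof -
  have alg: "D \<subseteq> BH" "csubspace D" "\<And>A B. A \<in> D \<Longrightarrow> B \<in> D \<Longrightarrow> A o\<^sub>L B \<in> D"
    "\<And>A B. A \<in> D \<Longrightarrow> B \<in> D \<Longrightarrow> A o\<^sub>L B = B o\<^sub>L A"
    "\<And>A. A \<in> D \<Longrightarrow> \<exists>S\<in>D. is_adjoint S A"
    using D unfolding masa_def abelian_selfadjoint_algebra_def by blast+
  note D_add = complex_vector.subspace_add[OF alg(2)]
    and D_scale = complex_vector.subspace_scale[OF alg(2)]
    and D_0 = complex_vector.subspace_0[OF alg(2)]
  \<comment> \<open>The scalar multiples of \<open>P\<close> form a separate summand because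
    \<open>D\<close> is not yet known to contain the identity; that is derived from this
    lemma.\<close>
  define E where "E = {A + (B o\<^sub>L P) + c *\<^sub>C P | A B c. A \<in> D \<and> B \<in> D}"
  have E_I: "A + (B o\<^sub>L P) + c *\<^sub>C P \<in> E" if "A \<in> D" "B \<in> D" for A B c
    using that unfolding E_def by blast
  have E_E: "\<exists>A B c. A \<in> D \<and> B \<in> D \<and> T = A + (B o\<^sub>L P) + c *\<^sub>C P" if "T \<in> E" for T
    using that unfolding E_def by blast
  \<comment> \<open>Commutation moves every \<open>P\<close> to the right, and idempotence collapses
    repeated factors. Once elements of \<open>D\<close> commute, the resulting expression is
    symmetric in the two factors.\<close>
  have prod: "(A + (B o\<^sub>L P) + c *\<^sub>C P) o\<^sub>L (A' + (B' o\<^sub>L P) + c' *\<^sub>C P) =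
      (A o\<^sub>L A') + (((A o\<^sub>L B') + c' *\<^sub>C A + (B o\<^sub>L A') + (B o\<^sub>L B') + c' *\<^sub>C B + c *\<^sub>C A' + c *\<^sub>C B') o\<^sub>L P)
        + (c * c') *\<^sub>C P"
    if "A \<in> D" "B \<in> D" "A' \<in> D" "B' \<in> D" for A B A' B' c c'
  proof (rule blinfun_eqI)
    fix x
    have [simp]: "blinfun_apply P (blinfun_apply P x) = blinfun_apply P x" for x
      using arg_cong[OF P(2), of "\<lambda>T. blinfun_apply T x"] by simp
    have [simp]: "blinfun_apply P (blinfun_apply C x) = blinfun_apply C (blinfun_apply P x)"
      if "C \<in> D" for C x
      using arg_cong[OF comm[OF that], of "\<lambda>T. blinfun_apply T x"] by simp
    have BH: "A \<in> BH" "B \<in> BH" "P \<in> BH"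
      using that P(1) alg(1) by blast+
    have BH': "A' \<in> BH" "B' \<in> BH"
      using that alg(1) by blast+
    show "blinfun_apply ((A + (B o\<^sub>L P) + c *\<^sub>C P) o\<^sub>L (A' + (B' o\<^sub>L P) + c' *\<^sub>C P)) x =
      blinfun_apply ((A o\<^sub>L A') + (((A o\<^sub>L B') + c' *\<^sub>C A + (B o\<^sub>L A') + (B o\<^sub>L B') + c' *\<^sub>C B + c *\<^sub>C A'
        + c *\<^sub>C B') o\<^sub>L P) + (c * c') *\<^sub>C P) x"
      using that
      by (simp add: blinfun.add_left blinfun.add_right scaleC_blinfun.rep_eq BH[THEN BH_scaleC]
          BH'[THEN BH_scaleC] scaleC_add_right scaleC_scaleC algebra_simps)
  qed
  have "abelian_selfadjoint_algebra E"
    unfolding abelian_selfadjoint_algebra_def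
  proof (intro conjI ballI)
    show "E \<subseteq> BH"
      using alg(1) P(1) unfolding E_def
      by (auto intro!: BH_add BH_compose complex_vector.subspace_scale[OF csubspace_BH])
    show "csubspace E"
      unfolding complex_vector.subspace_def
    proof (intro conjI allI ballI)
      show "0 \<in> E"
        using E_I[OF D_0 D_0, of 0] by simp
    next
      fix S T assume "S \<in> E" "T \<in> E"
      then obtain A B c A' B' c' where AB: "A \<in> D" "B \<in> D" "A' \<in> D" "B' \<in> D"
        and S: "S = A + (B o\<^sub>L P) + c *\<^sub>C P" and T: "T = A' + (B' o\<^sub>L P) + c' *\<^sub>C P"
        using E_E by meson
      have "S + T = (A + A') + ((B + B') o\<^sub>L P) + (c + c') *\<^sub>C P"
        unfolding S T by (intro blinfun_eqI) (simp add: blinfun.add_left scaleC_blinfun.rep_eq scaleC_add_left)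
      then show "S + T \<in> E"
        using E_I D_add AB by simp
    next
      fix a S assume "S \<in> E"
      then obtain A B c where AB: "A \<in> D" "B \<in> D" and S: "S = A + (B o\<^sub>L P) + c *\<^sub>C P"
        using E_E by meson
      have "a *\<^sub>C S = a *\<^sub>C A + ((a *\<^sub>C B) o\<^sub>L P) + (a * c) *\<^sub>C P"
        unfolding S by (simp add: scaleC_compose_left scaleC_add_right scaleC_scaleC)
      then show "a *\<^sub>C S \<in> E"
        using E_I D_scale AB by simp
    qed
  next
    fix S T assume "S \<in> E" "T \<in> E"
    then obtain A B c A' B' c' where AB: "A \<in> D" "B \<in> D" "A' \<in> D" "B' \<in> D"
      and S: "S = A + (B o\<^sub>L P) + c *\<^sub>C P" and T: "T = A' + (B' o\<^sub>L P) + c' *\<^sub>C P"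
      using E_E by meson
    show "S o\<^sub>L T \<in> E"
      unfolding S T prod[OF AB] using AB
      by (intro E_I D_add D_scale alg(3))
    have "A o\<^sub>L A' = A' o\<^sub>L A" "A o\<^sub>L B' = B' o\<^sub>L A" "B o\<^sub>L A' = A' o\<^sub>L B" "B o\<^sub>L B' = B' o\<^sub>L B"
      using AB alg(4) by blast+
    then show "S o\<^sub>L T = T o\<^sub>L S"
      unfolding S T prod[OF AB] prod[OF AB(3,4,1,2)] by (simp add: algebra_simps)
  next
    fix T assume "T \<in> E"
    then obtain A B c where AB: "A \<in> D" "B \<in> D" and T: "T = A + (B o\<^sub>L P) + c *\<^sub>C P"
      using E_E by meson
    obtain A' B' where AB': "A' \<in> D" "B' \<in> D" "is_adjoint A' A" "is_adjoint B' B"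
      using alg(5) AB by meson
    \<comment> \<open>The adjoint of \<open>B o\<^sub>L P\<close> is \<open>P o\<^sub>L B'\<close>,
      which commutation brings back to the form required in \<open>E\<close>.\<close>
    have "is_adjoint (A' + (P o\<^sub>L B') + cnj c *\<^sub>C P) T"
      unfolding T by (intro is_adjoint_add is_adjoint_compose is_adjoint_scaleC AB' P(3))
    then show "\<exists>S\<in>E. is_adjoint S T"
      using E_I[OF AB'(1,2)] unfolding comm[OF AB'(2), symmetric] by blast
  qed
  moreover have "D \<subseteq> E"
    using E_I[OF _ D_0, of _ 0] by auto
  ultimately have "E = D"
    using D unfolding masa_def by blast
  then show ?thesis
    using E_I[OF D_0 D_0, of 1] by (simp add: scaleC_one)
qed

lemma masaD:
  assumes "masa D"
  shows "D \<subseteq> BH" "csubspace D" "\<And>A B. A \<in> D \<Longrightarrow> B \<in> D \<Longrightarrow> A o\<^sub>L B \<in> D"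
    "\<And>A. A \<in> D \<Longrightarrow> \<exists>S\<in>D. is_adjoint S A"
  using assms unfolding masa_def abelian_selfadjoint_algebra_def by blast+

lemma masa_id:
  assumes "masa D"
  shows "id_blinfun \<in> D"
  by (rule masa_contains_commuting_projection[OF assms BH_id])
     (auto simp: is_adjoint_def intro: blinfun_eqI)

text \<open>Since \<open>D\<close> is selfadjoint, invariance of \<open>M\<close> under
  \<open>D\<close> includes invariance under adjoints, so \<open>P\<close> commutes with
  \<open>D\<close>.\<close>

lemma masa_contains_invariant_projection:
  assumes D: "masa D" and P: "orthogonal_projection M P" and M: "csubspace M"
    and inv: "\<And>A x. A \<in> D \<Longrightarrow> x \<in> M \<Longrightarrow> blinfun_apply A x \<in> M"
  shows "P \<in> D"
proof (rule masa_contains_commuting_projection[OF D])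
  note sub = csubspace_imp_subspace[OF M]
  show "P \<in> BH" using P by (simp add: orthogonal_projection_def)
  show "P o\<^sub>L P = P" by (rule orthogonal_projection_idem[OF P sub])
  show "is_adjoint P P" by (rule orthogonal_projection_self_adjoint[OF P])
  fix A assume A: "A \<in> D"
  then obtain S where "S \<in> D" "is_adjoint S A"
    using masaD(4)[OF D] by blast
  then show "A o\<^sub>L P = P o\<^sub>L A"
    using orthogonal_projection_commute[OF P M] inv A by blast
qed

subsection \<open>The Arveson distance and Schur idempotents\<close>

lemma norm_INF_lower: "a \<in> X \<Longrightarrow> (INF x\<in>X. norm (f x)) \<le> norm (f a)"
  by (rule cINF_lower) (auto intro: bdd_belowI2[of _ 0])

text \<open>The choice \<open>S = 0\<close> bounds each infimum by \<open>norm T\<close>, so the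
  supremum in \<open>arveson_dist\<close> is a genuine one.\<close>

lemma bdd_above_arveson:
  assumes "0 \<in> X"
  shows "bdd_above (insert 0
    ((\<lambda>\<xi>. INF S\<in>X. norm (blinfun_apply T \<xi> - blinfun_apply S \<xi>)) ` {\<xi>. norm \<xi> = 1}))"
proof (rule bdd_aboveI[of _ "norm T"])
  fix r assume "r \<in> insert 0
    ((\<lambda>\<xi>. INF S\<in>X. norm (blinfun_apply T \<xi> - blinfun_apply S \<xi>)) ` {\<xi>. norm \<xi> = 1})"
  then show "r \<le> norm T"
  proof
    assume "r \<in> (\<lambda>\<xi>. INF S\<in>X. norm (blinfun_apply T \<xi> - blinfun_apply S \<xi>)) ` {\<xi>. norm \<xi> = 1}"
    then obtain \<xi> where \<xi>: "norm \<xi> = 1"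
      and r: "r = (INF S\<in>X. norm (blinfun_apply T \<xi> - blinfun_apply S \<xi>))"
      by blast
    show "r \<le> norm T"
      using norm_INF_lower[OF assms, of "\<lambda>S. blinfun_apply T \<xi> - blinfun_apply S \<xi>"]
        norm_blinfun[of T \<xi>] \<xi> unfolding r by simp
  qed simp
qed

lemma arveson_dist_nonneg: "0 \<in> X \<Longrightarrow> 0 \<le> arveson_dist T X"
  unfolding arveson_dist_def by (rule cSup_upper[OF _ bdd_above_arveson]) auto

text \<open>Homogeneity extends the defining estimate from unit vectors to all vectors; it is
  applied to projected vectors, whose norm may be less than 1.\<close>

lemma INF_le_arveson_dist:
  assumes X: "0 \<in> X"
  shows "(INF S\<in>X. norm (blinfun_apply T \<zeta> - blinfun_apply S \<zeta>)) \<le> arveson_dist T X * norm \<zeta>"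
    (is "?I \<zeta> \<le> _")
proof (cases "\<zeta> = 0")
  case True
  then show ?thesis
    using norm_INF_lower[OF X, of "\<lambda>S. blinfun_apply T \<zeta> - blinfun_apply S \<zeta>"] by simp
next
  case False
  define u where "u = (1 / norm \<zeta>) *\<^sub>R \<zeta>"
  have u: "norm u = 1" and \<zeta>: "\<zeta> = norm \<zeta> *\<^sub>R u"
    using False by (simp_all add: u_def)
  have "?I \<zeta> / norm \<zeta> \<le> ?I u"
  proof (rule cINF_greatest)
    fix S assume S: "S \<in> X"
    have "?I \<zeta> \<le> norm (blinfun_apply T \<zeta> - blinfun_apply S \<zeta>)"
      by (rule norm_INF_lower[OF S])
    also have "blinfun_apply T \<zeta> - blinfun_apply S \<zeta> =
        norm \<zeta> *\<^sub>R (blinfun_apply T u - blinfun_apply S u)"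
      by (subst (1 2) \<zeta>) (simp only: blinfun.scaleR_right scaleR_diff_right)
    finally show "?I \<zeta> / norm \<zeta> \<le> norm (blinfun_apply T u - blinfun_apply S u)"
      using False by (simp add: divide_le_eq mult.commute)
  qed (use X in auto)
  also have "?I u \<le> arveson_dist T X"
    unfolding arveson_dist_def using u by (intro cSup_upper bdd_above_arveson X) auto
  finally show ?thesis
    using False by (simp add: divide_le_eq)
qed

lemma arveson_dist_le:
  assumes "0 \<le> c"
    and "\<And>\<xi>. norm \<xi> = 1 \<Longrightarrow> (INF S\<in>X. norm (blinfun_apply T \<xi> - blinfun_apply S \<xi>)) \<le> c"
  shows "arveson_dist T X \<le> c"
  unfolding arveson_dist_def by (rule cSup_least) (use assms in auto)

lemma arveson_dist_self:
  assumes "0 \<in> X" "T \<in> X"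
  shows "arveson_dist T X = 0"
proof (rule antisym)
  show "arveson_dist T X \<le> 0"
  proof (rule arveson_dist_le)
    fix \<xi> show "(INF S\<in>X. norm (blinfun_apply T \<xi> - blinfun_apply S \<xi>)) \<le> 0"
      using norm_INF_lower[OF assms(2), of "\<lambda>S. blinfun_apply T \<xi> - blinfun_apply S \<xi>"] by simp
  qed simp
qed (rule arveson_dist_nonneg[OF assms(1)])

section \<open>Schur idempotents and their complementary maps\<close>

lemma schur_idempotentD:
  assumes "schur_idempotent D \<Phi>"
  shows "\<And>T. T \<in> BH \<Longrightarrow> \<Phi> T \<in> BH"
    "\<And>S T. S \<in> BH \<Longrightarrow> T \<in> BH \<Longrightarrow> \<Phi> (S + T) = \<Phi> S + \<Phi> T"
    "\<And>c T. T \<in> BH \<Longrightarrow> \<Phi> (c *\<^sub>C T) = c *\<^sub>C \<Phi> T"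
    "\<And>A T B. A \<in> D \<Longrightarrow> T \<in> BH \<Longrightarrow> B \<in> D \<Longrightarrow> \<Phi> (A o\<^sub>L T o\<^sub>L B) = A o\<^sub>L \<Phi> T o\<^sub>L B"
    "continuous_map weak_star_topology weak_star_topology \<Phi>"
    "\<And>T. T \<in> BH \<Longrightarrow> \<Phi> (\<Phi> T) = \<Phi> T"
  using assms unfolding schur_idempotent_def by blast+

lemma mem_Ran_iff:
  assumes "schur_idempotent D \<Phi>"
  shows "T \<in> Ran \<Phi> \<longleftrightarrow> T \<in> BH \<and> \<Phi> T = T"
  unfolding Ran_def image_iff using schur_idempotentD(1,6)[OF assms] by metis

lemma map_perp_BH:
  assumes "schur_idempotent D \<Phi>" "T \<in> BH"
  shows "map_perp \<Phi> T \<in> BH"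
  unfolding map_perp_def by (intro BH_diff schur_idempotentD(1)[OF assms(1)] assms(2))

lemma map_perp_add:
  assumes "schur_idempotent D \<Phi>" "S \<in> BH" "T \<in> BH"
  shows "map_perp \<Phi> (S + T) = map_perp \<Phi> S + map_perp \<Phi> T"
  by (simp add: map_perp_def schur_idempotentD(2)[OF assms])

lemma map_perp_Ran:
  assumes "schur_idempotent D \<Phi>" "T \<in> Ran \<Phi>"
  shows "map_perp \<Phi> T = 0"
  using assms(2) mem_Ran_iff[OF assms(1)] by (simp add: map_perp_def)

lemma map_perp_bimodule:
  assumes "schur_idempotent D \<Phi>" "A \<in> D" "T \<in> BH" "B \<in> D"
  shows "map_perp \<Phi> (A o\<^sub>L T o\<^sub>L B) = A o\<^sub>L map_perp \<Phi> T o\<^sub>L B"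
  unfolding map_perp_def schur_idempotentD(4)[OF assms]
  by (rule blinfun_eqI) (simp add: blinfun.diff_left blinfun.diff_right)

lemma csubspace_Ran:
  assumes "schur_idempotent D \<Phi>"
  shows "csubspace (Ran \<Phi>)"
proof -
  have "\<Phi> 0 = 0"
    using schur_idempotentD(3)[OF assms complex_vector.subspace_0[OF csubspace_BH], of 0] by simp
  then show ?thesis
    using csubspace_BH schur_idempotentD(2,3)[OF assms]
    by (auto simp: complex_vector.subspace_def mem_Ran_iff[OF assms])
qed

lemma Ran_bimodule:
  assumes "masa D" "schur_idempotent D \<Phi>" "A \<in> D" "T \<in> Ran \<Phi>" "B \<in> D"
  shows "A o\<^sub>L T o\<^sub>L B \<in> Ran \<Phi>"
  using assms(4) masaD(1)[OF assms(1)] schur_idempotentD(4)[OF assms(2,3) _ assms(5), of T] assms(3,5)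
  by (auto simp: mem_Ran_iff[OF assms(2)] intro!: BH_compose)

text \<open>
  Fix a unit vector \<open>\<xi>\<close>. The projections \<open>P\<close> onto the closure of \<open>D\<xi>\<close> and \<open>Q\<close> onto the orthogonal
  complement of \<open>X\<xi>\<close> lie in \<open>D\<close> by maximality, and \<open>Q X P = 0\<close>. So the distance from
  \<open>\<Phi>\<^sup>\<bottom>(T)\<xi>\<close> to \<open>X\<xi>\<close> is the norm of \<open>\<Phi>\<^sup>\<bottom>(Q T P)\<xi>\<close>, while \<open>Q\<close> and \<open>P\<close> do not see the summand of
  \<open>W\<close> in \<open>X\<close>.
\<close>

lemma arveson_dist_map_perp_le:
  fixes D X W :: "('h::complex_hilbert_space \<Rightarrow>\<^sub>L 'h) set"
  assumes D: "masa D" and \<Phi>: "schur_idempotent D \<Phi>"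
    and l: "0 \<le> l" "\<And>T. T \<in> BH \<Longrightarrow> norm (map_perp \<Phi> T) \<le> l * arveson_dist T (Ran \<Phi>)"
    and X: "X \<subseteq> BH" "csubspace X"
      "\<And>A S B. A \<in> D \<Longrightarrow> S \<in> X \<Longrightarrow> B \<in> D \<Longrightarrow> A o\<^sub>L S o\<^sub>L B \<in> X"
    and W: "0 \<in> W" "W \<subseteq> {S + R | S R. S \<in> X \<and> R \<in> Ran \<Phi>}"
    and T: "T \<in> BH"
  shows "arveson_dist (map_perp \<Phi> T) X \<le> l * arveson_dist T W"
proof (rule arveson_dist_le)
  show "0 \<le> l * arveson_dist T W"
    using l(1) arveson_dist_nonneg[OF W(1)] by simp
next
  fix \<xi> :: 'h assume \<xi>: "norm \<xi> = 1"
  have cyclic_csubspace: "csubspace ((\<lambda>S. blinfun_apply S \<xi>) ` Y)"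
    if "csubspace Y" for Y :: "('h \<Rightarrow>\<^sub>L 'h) set"
    unfolding complex_vector.subspace_def
  proof (intro conjI allI ballI)
    show "0 \<in> (\<lambda>S. blinfun_apply S \<xi>) ` Y"
      using complex_vector.subspace_0[OF that] by (metis image_eqI blinfun.zero_left)
    fix x c assume "x \<in> (\<lambda>S. blinfun_apply S \<xi>) ` Y"
    then obtain S where S: "S \<in> Y" "x = blinfun_apply S \<xi>" by blast
    then show "c *\<^sub>C x \<in> (\<lambda>S. blinfun_apply S \<xi>) ` Y"
      using complex_vector.subspace_scale[OF that S(1), of c]
      by (metis image_eqI scaleC_blinfun.rep_eq)
    fix y assume "y \<in> (\<lambda>S. blinfun_apply S \<xi>) ` Y"
    then obtain S' where S': "S' \<in> Y" "y = blinfun_apply S' \<xi>" by blast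
    show "x + y \<in> (\<lambda>S. blinfun_apply S \<xi>) ` Y"
      using complex_vector.subspace_add[OF that S(1) S'(1)] S(2) S'(2)
      by (metis image_eqI blinfun.add_left)
  qed
  define M N where "M = closure ((\<lambda>A. blinfun_apply A \<xi>) ` D)"
    and "N = closure ((\<lambda>S. blinfun_apply S \<xi>) ` X)"
  have M: "csubspace M" and N: "csubspace N"
    unfolding M_def N_def
    using csubspace_closure cyclic_csubspace X(2) masaD(2)[OF D] by blast+
  obtain P where P: "orthogonal_projection M P"
    using orthogonal_projection_exists[OF M] M_def by auto
  obtain P' where P': "orthogonal_projection N P'"
    using orthogonal_projection_exists[OF N] N_def by auto
  have id_compose: "A o\<^sub>L id_blinfun = A" "id_blinfun o\<^sub>L A = A" for A :: "'h \<Rightarrow>\<^sub>L 'h"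
    by (auto intro: blinfun_eqI)
  have X_id: "A o\<^sub>L S \<in> X" "S o\<^sub>L A \<in> X" if "A \<in> D" "S \<in> X" for A S
    using X(3)[OF that masa_id[OF D]] X(3)[OF masa_id[OF D] that(2,1)] by (simp_all add: id_compose)
  have closure_maps: "blinfun_apply S x \<in> closure Z"
    if "x \<in> closure Y" "\<And>y. y \<in> Y \<Longrightarrow> blinfun_apply S y \<in> Z" for S :: "'h \<Rightarrow>\<^sub>L 'h" and x Y Z
    using image_closure_subset[of Y "blinfun_apply S" "closure Z"] that closure_subset[of Z]
      linear_continuous_on[OF blinfun.bounded_linear_right, of "closure Y" S] by blast
  have "blinfun_apply A x \<in> M" if "A \<in> D" "x \<in> M" for A x
    using that(2) unfolding M_def
  proof (rule closure_maps)
    fix y assume "y \<in> (\<lambda>A. blinfun_apply A \<xi>) ` D"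
    then obtain B where "B \<in> D" "y = blinfun_apply B \<xi>" by blast
    then show "blinfun_apply A y \<in> (\<lambda>A. blinfun_apply A \<xi>) ` D"
      using masaD(3)[OF D that(1)] by (metis blinfun_apply_blinfun_compose image_eqI)
  qed
  then have PD: "P \<in> D"
    by (rule masa_contains_invariant_projection[OF D P M])
  have "blinfun_apply A x \<in> N" if "A \<in> D" "x \<in> N" for A x
    using that(2) unfolding N_def
  proof (rule closure_maps)
    fix y assume "y \<in> (\<lambda>A. blinfun_apply A \<xi>) ` X"
    then obtain B where "B \<in> X" "y = blinfun_apply B \<xi>" by blast
    then show "blinfun_apply A y \<in> (\<lambda>A. blinfun_apply A \<xi>) ` X"
      using X_id(1)[OF that(1)] by (metis blinfun_apply_blinfun_compose image_eqI)
  qed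
  then have "P' \<in> D"
    by (rule masa_contains_invariant_projection[OF D P' N])
  define Q where "Q = id_blinfun - P'"
  have QD: "Q \<in> D"
    unfolding Q_def
    by (rule complex_vector.subspace_diff[OF masaD(2)[OF D] masa_id[OF D] \<open>P' \<in> D\<close>])
  have Q_apply: "blinfun_apply Q x = x - blinfun_apply P' x" for x
    by (simp add: Q_def blinfun.diff_left)
  have P'_mem: "blinfun_apply P' x \<in> N" and P_mem: "blinfun_apply P x \<in> M" for x
    using P P' by (simp_all add: orthogonal_projection_def)
  \<comment> \<open>\<open>P x\<close> is a limit of vectors \<open>B \<xi>\<close> with
    \<open>B\<close> in \<open>D\<close>, and \<open>S o\<^sub>L B\<close> is again in
    \<open>X\<close>; hence \<open>S (P x)\<close> lies in \<open>N\<close>, where \<open>Q\<close>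
    vanishes.\<close>
  have QSP: "blinfun_apply Q (blinfun_apply S (blinfun_apply P x)) = 0" if "S \<in> X" for S x
  proof -
    have "blinfun_apply S (blinfun_apply P x) \<in> N"
      using P_mem[of x] unfolding M_def N_def
    proof (rule closure_maps)
      fix y assume "y \<in> (\<lambda>A. blinfun_apply A \<xi>) ` D"
      then obtain B where "B \<in> D" "y = blinfun_apply B \<xi>" by blast
      then show "blinfun_apply S y \<in> (\<lambda>A. blinfun_apply A \<xi>) ` X"
        using X_id(2)[OF _ that] by (metis blinfun_apply_blinfun_compose image_eqI)
    qed
    then show ?thesis
      using orthogonal_projection_fixes[OF P' csubspace_imp_subspace[OF N]] by (simp add: Q_apply)
  qed
  have Q_norm: "norm (blinfun_apply Q x) \<le> norm x" for x
  proof -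
    have "inner (x - blinfun_apply P' x) (blinfun_apply P' x) = 0"
      using P' by (simp add: orthogonal_projection_def)
    then have "(norm (blinfun_apply Q x))\<^sup>2 = inner x (blinfun_apply Q x)"
      by (simp add: Q_apply power2_norm_eq_inner inner_diff_left inner_diff_right inner_commute)
    also have "\<dots> \<le> norm x * norm (blinfun_apply Q x)"
      by (rule norm_cauchy_schwarz)
    finally show ?thesis
      by (metis mult_le_cancel_right norm_ge_zero not_less_iff_gr_or_eq not_le power2_eq_square)
  qed
  have P_norm: "norm (blinfun_apply P x) \<le> norm x" for x
  proof -
    have "inner (x - blinfun_apply P x) (blinfun_apply P x) = 0"
      using P by (simp add: orthogonal_projection_def)
    then have "(norm (blinfun_apply P x))\<^sup>2 = inner x (blinfun_apply P x)"
      by (simp add: power2_norm_eq_inner inner_diff_left)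
    also have "\<dots> \<le> norm x * norm (blinfun_apply P x)"
      by (rule norm_cauchy_schwarz)
    finally show ?thesis
      by (metis mult_le_cancel_right norm_ge_zero not_less_iff_gr_or_eq not_le power2_eq_square)
  qed
  define R where "R = map_perp \<Phi> T"
  have "\<xi> \<in> (\<lambda>A. blinfun_apply A \<xi>) ` D"
    by (rule image_eqI[OF _ masa_id[OF D]]) simp
  then have "\<xi> \<in> M"
    unfolding M_def by (rule subsetD[OF closure_subset])
  then have P\<xi>: "blinfun_apply P \<xi> = \<xi>"
    by (rule orthogonal_projection_fixes[OF P csubspace_imp_subspace[OF M]])
  have BH: "P \<in> BH" "Q \<in> BH" "Q o\<^sub>L T o\<^sub>L P \<in> BH"
    using PD QD masaD(1)[OF D] T by (auto intro!: BH_compose)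
  \<comment> \<open>The infimum over the vectors \<open>S \<xi>\<close> also bounds the distance to
    points of their closure \<open>N\<close>, in particular to the projection of
    \<open>R \<xi>\<close> onto \<open>N\<close>.\<close>
  have "(INF S\<in>X. norm (blinfun_apply R \<xi> - blinfun_apply S \<xi>)) \<le> norm (blinfun_apply Q (blinfun_apply R \<xi>))"
  proof -
    define I where "I = (INF S\<in>X. norm (blinfun_apply R \<xi> - blinfun_apply S \<xi>))"
    have "I \<le> norm (blinfun_apply R \<xi> - blinfun_apply P' (blinfun_apply R \<xi>))"
    proof -
      have "(\<lambda>S. blinfun_apply S \<xi>) ` X \<subseteq> {z. I \<le> norm (blinfun_apply R \<xi> - z)}"
        unfolding I_def using norm_INF_lower[of _ X "\<lambda>S. blinfun_apply R \<xi> - blinfun_apply S \<xi>"]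
        by auto
      moreover have "closed {z. I \<le> norm (blinfun_apply R \<xi> - z)}"
        by (intro closed_Collect_le continuous_intros)
      ultimately show ?thesis
        using closure_minimal P'_mem[of "blinfun_apply R \<xi>"] unfolding N_def by blast
    qed
    then show ?thesis unfolding I_def Q_apply .
  qed
  also have "blinfun_apply Q (blinfun_apply R \<xi>) = blinfun_apply (map_perp \<Phi> (Q o\<^sub>L T o\<^sub>L P)) \<xi>"
    unfolding map_perp_bimodule[OF \<Phi> QD T PD] R_def by (simp add: P\<xi>)
  also have "norm \<dots> \<le> norm (map_perp \<Phi> (Q o\<^sub>L T o\<^sub>L P))"
    using norm_blinfun[of _ \<xi>] \<xi> by (metis mult.right_neutral)
  also have "\<dots> \<le> l * arveson_dist (Q o\<^sub>L T o\<^sub>L P) (Ran \<Phi>)"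
    by (rule l(2)[OF BH(3)])
  also have "\<dots> \<le> l * arveson_dist T W"
  proof (rule mult_left_mono[OF arveson_dist_le l(1)])
    show "0 \<le> arveson_dist T W" by (rule arveson_dist_nonneg[OF W(1)])
    fix \<eta> :: 'h assume \<eta>: "norm \<eta> = 1"
    define I where
      "I = (INF S\<in>Ran \<Phi>. norm (blinfun_apply (Q o\<^sub>L T o\<^sub>L P) \<eta> - blinfun_apply S \<eta>))"
    have "I \<le> (INF S\<in>W. norm (blinfun_apply T (blinfun_apply P \<eta>) - blinfun_apply S (blinfun_apply P \<eta>)))"
    proof (rule cINF_greatest)
      fix Y assume "Y \<in> W"
      then obtain S Z where Y: "Y = S + Z" "S \<in> X" "Z \<in> Ran \<Phi>"
        using W(2) by blast
      \<comment> \<open>The competitor \<open>Q o\<^sub>L Z o\<^sub>L P\<close> lies in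
        \<open>Ran \<Phi>\<close> by modularity. As \<open>Q\<close> and \<open>P\<close> kill
        \<open>S\<close>, it has the same effect as compressing all of \<open>Y\<close>.\<close>
      have "I \<le> norm (blinfun_apply (Q o\<^sub>L T o\<^sub>L P) \<eta> - blinfun_apply (Q o\<^sub>L Z o\<^sub>L P) \<eta>)"
        unfolding I_def by (rule norm_INF_lower) (rule Ran_bimodule[OF D \<Phi> QD Y(3) PD])
      also have "blinfun_apply (Q o\<^sub>L T o\<^sub>L P) \<eta> - blinfun_apply (Q o\<^sub>L Z o\<^sub>L P) \<eta> =
          blinfun_apply Q (blinfun_apply T (blinfun_apply P \<eta>) - blinfun_apply Y (blinfun_apply P \<eta>))"
        by (simp add: Y(1) blinfun.diff_right blinfun.add_left blinfun.add_right QSP[OF Y(2)])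
      also have "norm \<dots> \<le> norm (blinfun_apply T (blinfun_apply P \<eta>) - blinfun_apply Y (blinfun_apply P \<eta>))"
        by (rule Q_norm)
      finally show "I \<le> norm (blinfun_apply T (blinfun_apply P \<eta>) - blinfun_apply Y (blinfun_apply P \<eta>))" .
    qed (use W(1) in auto)
    also have "\<dots> \<le> arveson_dist T W * norm (blinfun_apply P \<eta>)"
      by (rule INF_le_arveson_dist[OF W(1)])
    also have "\<dots> \<le> arveson_dist T W * 1"
      using P_norm[of \<eta>] \<eta> arveson_dist_nonneg[OF W(1)] by (intro mult_left_mono) auto
    finally show "I \<le> arveson_dist T W" by simp
  qed
  finally show "(INF S\<in>X. norm (blinfun_apply (map_perp \<Phi> T) \<xi> - blinfun_apply S \<xi>)) \<le> l * arveson_dist T W"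
    unfolding R_def .
qed

text \<open>The preceding estimate with \<open>W = X\<close> bounds the Arveson distance of
  \<open>map_perp \<Phi> T\<close> to \<open>X\<close> by a multiple of that of \<open>T\<close>,
  which is 0.\<close>

lemma map_perp_invariant:
  assumes D: "masa D" and \<Phi>: "schur_idempotent D \<Phi>"
    and l: "0 \<le> l" "\<And>T. T \<in> BH \<Longrightarrow> norm (map_perp \<Phi> T) \<le> l * arveson_dist T (Ran \<Phi>)"
    and X: "X \<subseteq> BH" "csubspace X"
      "\<And>A S B. A \<in> D \<Longrightarrow> S \<in> X \<Longrightarrow> B \<in> D \<Longrightarrow> A o\<^sub>L S o\<^sub>L B \<in> X"
    and reflexive: "\<And>T. T \<in> BH \<Longrightarrow> arveson_dist T X = 0 \<Longrightarrow> T \<in> X"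
    and T: "T \<in> X"
  shows "map_perp \<Phi> T \<in> X"
proof (rule reflexive)
  have TBH: "T \<in> BH" using T X(1) by blast
  show "map_perp \<Phi> T \<in> BH" by (rule map_perp_BH[OF \<Phi> TBH])
  have X0: "0 \<in> X" by (rule complex_vector.subspace_0[OF X(2)])
  have "0 \<in> Ran \<Phi>" by (rule complex_vector.subspace_0[OF csubspace_Ran[OF \<Phi>]])
  then have "X \<subseteq> {S + R | S R. S \<in> X \<and> R \<in> Ran \<Phi>}"
    by force
  from arveson_dist_map_perp_le[OF D \<Phi> l X X0 this TBH]
  show "arveson_dist (map_perp \<Phi> T) X = 0"
    using arveson_dist_self[OF X0 T] arveson_dist_nonneg[OF X0] by (simp add: antisym)
qed

text \<open>
  The order only gives \<open>\<Psi>\<Phi> = \<Psi>\<close>. That \<open>\<Phi>\<Psi> = \<Psi>\<close> holds too follows without the commutativity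
  of Schur maps, because \<open>\<Psi>\<close> leaves the reflexive bimodule \<open>Ran \<Phi>\<close> invariant.
\<close>

lemma Ran_subset_if_schur_le:
  assumes D: "masa D" and \<Phi>: "schur_idempotent D \<Phi>" and \<Psi>: "schur_idempotent D \<Psi>"
    and l\<Phi>: "\<And>T. T \<in> BH \<Longrightarrow> norm (map_perp \<Phi> T) \<le> l * arveson_dist T (Ran \<Phi>)"
    and l\<Psi>: "0 \<le> l'" "\<And>T. T \<in> BH \<Longrightarrow> norm (map_perp \<Psi> T) \<le> l' * arveson_dist T (Ran \<Psi>)"
    and le: "schur_le \<Psi> \<Phi>"
  shows "Ran \<Psi> \<subseteq> Ran \<Phi>"
proof
  fix T assume "T \<in> Ran \<Psi>"
  then have T: "T \<in> BH" "\<Psi> T = T"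
    using mem_Ran_iff[OF \<Psi>] by auto
  have \<Phi>T: "\<Phi> T \<in> Ran \<Phi>"
    using T(1) by (simp add: Ran_def)
  have "map_perp \<Psi> (\<Phi> T) \<in> Ran \<Phi>"
  proof (rule map_perp_invariant[OF D \<Psi> l\<Psi> _ csubspace_Ran[OF \<Phi>] Ran_bimodule[OF D \<Phi>] _ \<Phi>T])
    show "Ran \<Phi> \<subseteq> BH"
      using mem_Ran_iff[OF \<Phi>] by blast
    \<comment> \<open>\<open>Ran \<Phi>\<close> is reflexive: Arveson distance 0 forces
      \<open>map_perp \<Phi> S = 0\<close>, that is, \<open>\<Phi> S = S\<close>.\<close>
    fix S assume "S \<in> BH" "arveson_dist S (Ran \<Phi>) = 0"
    then show "S \<in> Ran \<Phi>"
      using l\<Phi>[of S] mem_Ran_iff[OF \<Phi>] by (simp add: map_perp_def)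
  qed
  then have "\<Phi> T - map_perp \<Psi> (\<Phi> T) \<in> Ran \<Phi>"
    by (rule complex_vector.subspace_diff[OF csubspace_Ran[OF \<Phi>] \<Phi>T])
  \<comment> \<open>The left side is \<open>\<Psi> (\<Phi> T)\<close>, which the order turns into
    \<open>\<Psi> T = T\<close>.\<close>
  moreover have "\<Phi> T - map_perp \<Psi> (\<Phi> T) = T"
    using le T by (simp add: map_perp_def schur_le_def)
  ultimately show "T \<in> Ran \<Phi>" by simp
qed

subsection \<open>Weak* sequential compactness\<close>

lemma summable_norm_product:
  fixes \<xi> \<eta> :: "nat \<Rightarrow> 'a::real_normed_vector"
  assumes "summable (\<lambda>n. (norm (\<xi> n))\<^sup>2)" "summable (\<lambda>n. (norm (\<eta> n))\<^sup>2)"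
  shows "summable (\<lambda>n. norm (\<xi> n) * norm (\<eta> n))"
proof (rule summable_comparison_test')
  show "summable (\<lambda>n. (norm (\<xi> n))\<^sup>2 + (norm (\<eta> n))\<^sup>2)"
    by (rule summable_add[OF assms])
  fix n
  have "2 * (norm (\<xi> n) * norm (\<eta> n)) \<le> (norm (\<xi> n))\<^sup>2 + (norm (\<eta> n))\<^sup>2"
    using zero_le_power2[of "norm (\<xi> n) - norm (\<eta> n)"] by (simp add: power2_diff)
  moreover have "0 \<le> norm (\<xi> n) * norm (\<eta> n)" by simp
  ultimately show "norm (norm (\<xi> n) * norm (\<eta> n)) \<le> (norm (\<xi> n))\<^sup>2 + (norm (\<eta> n))\<^sup>2"
    unfolding real_norm_def by linarith
qed

lemma abs_inner_blinfun_le: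
  fixes T :: "'a::real_normed_vector \<Rightarrow>\<^sub>L 'b::real_inner"
  assumes "norm T \<le> C"
  shows "\<bar>inner (blinfun_apply T x) y\<bar> \<le> C * norm x * norm y"
proof -
  have "\<bar>inner (blinfun_apply T x) y\<bar> \<le> norm (blinfun_apply T x) * norm y"
    by (rule Cauchy_Schwarz_ineq2)
  also have "norm (blinfun_apply T x) \<le> C * norm x"
    using norm_blinfun[of T x] mult_right_mono[OF assms norm_ge_zero[of x]] by linarith
  finally show ?thesis by (simp add: mult_right_mono)
qed

lemma cmod_cinner_blinfun_le:
  fixes T :: "'h::complex_hilbert_space \<Rightarrow>\<^sub>L 'h"
  assumes "norm T \<le> C"
  shows "cmod (cinner (blinfun_apply T x) y) \<le> 2 * C * (norm x * norm y)"
proof -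
  have "norm (blinfun_apply T x) \<le> C * norm x"
    using norm_blinfun[of T x] mult_right_mono[OF assms norm_ge_zero[of x]] by linarith
  then have "norm (blinfun_apply T x) * norm y \<le> C * norm x * norm y"
    by (rule mult_right_mono) simp
  then show ?thesis
    using cmod_cinner_le[of "blinfun_apply T x" y] by (simp add: mult.assoc)
qed

section \<open>Predual functionals and the weak* topology\<close>

lemma summable_predual_series:
  fixes T :: "'h::complex_hilbert_space \<Rightarrow>\<^sub>L 'h"
  assumes "summable (\<lambda>n. (norm (\<xi> n))\<^sup>2)" "summable (\<lambda>n. (norm (\<eta> n))\<^sup>2)"
  shows "summable (\<lambda>n. cinner (blinfun_apply T (\<xi> n)) (\<eta> n))"
  by (rule summable_comparison_test'[OF
      summable_mult[OF summable_norm_product[OF assms], of "2 * norm T"]])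
     (rule cmod_cinner_blinfun_le[OF order_refl])

lemma predual_functionals_diff:
  assumes "\<phi> \<in> predual_functionals"
  shows "\<phi> (S - T) = \<phi> S - \<phi> T"
proof -
  obtain \<xi> \<eta> where \<phi>: "\<phi> = (\<lambda>T. \<Sum>n. cinner (blinfun_apply T (\<xi> n)) (\<eta> n))"
    and sm: "summable (\<lambda>n. (norm (\<xi> n))\<^sup>2)" "summable (\<lambda>n. (norm (\<eta> n))\<^sup>2)"
    using assms unfolding predual_functionals_def by blast
  have "cinner (x - y) z = cinner x z - cinner y z" for x y z :: 'a
    using cinner_add_left[of "x - y" y z] by simp
  then show ?thesis
    unfolding \<phi> by (simp add: blinfun.diff_left suminf_diff summable_predual_series[OF sm])
qed

text \<open>The one-term case of the defining series: both sequences vanish beyond index 0.\<close>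

lemma vector_functional_predual:
  "(\<lambda>T. cinner (blinfun_apply T x) y) \<in> predual_functionals"
proof -
  define \<xi> \<eta> where "\<xi> n = (if n = 0 then x else 0)" and "\<eta> n = (if n = 0 then y else 0)" for n :: nat
  have "(\<lambda>n. if n = 0 then cinner (blinfun_apply T x) y else 0) sums cinner (blinfun_apply T x) y" for T
    using sums_single[of 0 "\<lambda>_. cinner (blinfun_apply T x) y"] by simp
  moreover have "(\<lambda>n. cinner (blinfun_apply T (\<xi> n)) (\<eta> n)) =
      (\<lambda>n. if n = 0 then cinner (blinfun_apply T x) y else 0)" for T
    by (auto simp: \<xi>_def \<eta>_def cinner_eq_inner Complex_eq_0)
  ultimately have "cinner (blinfun_apply T x) y = (\<Sum>n. cinner (blinfun_apply T (\<xi> n)) (\<eta> n))" for T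
    by (simp add: sums_iff)
  moreover have "summable (\<lambda>n. (norm (\<xi> n))\<^sup>2)" "summable (\<lambda>n. (norm (\<eta> n))\<^sup>2)"
    by (auto intro!: summable_finite[of "{0}"] simp: \<xi>_def \<eta>_def split: if_splits)
  ultimately show ?thesis
    unfolding predual_functionals_def by blast
qed

lemma topspace_weak_star [simp]: "topspace weak_star_topology = BH"
proof -
  have "BH \<subseteq> \<Union> {{T \<in> BH. \<phi> T \<in> G} | \<phi> G. \<phi> \<in> predual_functionals \<and> open (G :: complex set)}"
    using vector_functional_predual by (fastforce intro: exI[of _ UNIV])
  then show ?thesis
    unfolding weak_star_topology_def by auto
qed

lemma continuous_predual_functional:
  assumes "\<phi> \<in> predual_functionals"
  shows "continuous_map weak_star_topology euclidean \<phi>"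
  unfolding continuous_map_def
proof (intro conjI allI impI)
  fix G :: "complex set" assume "openin euclidean G"
  then show "openin weak_star_topology {T \<in> topspace weak_star_topology. \<phi> T \<in> G}"
    unfolding topspace_weak_star using assms
    by (auto simp: weak_star_topology_def intro!: topology_generated_by_Basis)
qed auto

text \<open>Convergence need only be checked on the generating sets; the induction carries it
  through finite intersections and unions.\<close>

lemma limitin_weak_star:
  assumes T: "T \<in> BH" and X: "\<forall>\<^sub>F n in F. X n \<in> BH"
    and lim: "\<And>\<phi>. \<phi> \<in> predual_functionals \<Longrightarrow> ((\<lambda>n. \<phi> (X n)) \<longlongrightarrow> \<phi> T) F"
  shows "limitin weak_star_topology X T F"
  unfolding limitin_def
proof (intro conjI allI impI)
  fix G assume "openin weak_star_topology G \<and> T \<in> G"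
  then have "generate_topology_on {{T \<in> BH. \<phi> T \<in> G} | \<phi> G. \<phi> \<in> predual_functionals \<and> open G} G"
    and "T \<in> G"
    by (auto simp: weak_star_topology_def openin_topology_generated_by_iff)
  then show "\<forall>\<^sub>F n in F. X n \<in> G"
  proof induction
    case (Int a b)
    then show ?case by (simp add: eventually_conj)
  next
    case (UN K)
    then obtain k where "k \<in> K" "T \<in> k" by blast
    then have "\<forall>\<^sub>F n in F. X n \<in> k" by (rule UN.IH)
    then show ?case by eventually_elim (use \<open>k \<in> K\<close> in blast)
  next
    case (Basis s)
    then obtain \<phi> G where s: "s = {T \<in> BH. \<phi> T \<in> G}" "\<phi> \<in> predual_functionals" "open G" "\<phi> T \<in> G"
      by blast
    have "\<forall>\<^sub>F n in F. \<phi> (X n) \<in> G"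
      by (rule topological_tendstoD[OF lim[OF s(2)] s(3,4)])
    with X show ?case
      unfolding s(1) by eventually_elim blast
  qed simp
qed (use T in simp)

text \<open>On bounded sequences convergence of matrix coefficients suffices: Tannery's theorem
  exchanges limit and series, with the summable majorant
  \<open>2 * C * (norm (\<xi> n) * norm (\<eta> n))\<close>.\<close>

lemma limitin_weak_star_bounded:
  fixes X :: "nat \<Rightarrow> 'h::complex_hilbert_space \<Rightarrow>\<^sub>L 'h"
  assumes T: "T \<in> BH" and X: "\<And>n. X n \<in> BH" "\<And>n. norm (X n) \<le> C"
    and lim: "\<And>x y. (\<lambda>n. inner (blinfun_apply (X n) x) y) \<longlonglongrightarrow> inner (blinfun_apply T x) y"
  shows "limitin weak_star_topology X T sequentially"
proof (rule limitin_weak_star[OF T])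
  fix \<phi> :: "('h \<Rightarrow>\<^sub>L 'h) \<Rightarrow> complex" assume "\<phi> \<in> predual_functionals"
  then obtain \<xi> \<eta> where \<phi>: "\<phi> = (\<lambda>T. \<Sum>n. cinner (blinfun_apply T (\<xi> n)) (\<eta> n))"
    and sm: "summable (\<lambda>n. (norm (\<xi> n))\<^sup>2)" "summable (\<lambda>n. (norm (\<eta> n))\<^sup>2)"
    unfolding predual_functionals_def by blast
  have limc: "(\<lambda>n. cinner (blinfun_apply (X n) x) y) \<longlonglongrightarrow> cinner (blinfun_apply T x) y" for x y
    unfolding cinner_eq_inner by (intro tendsto_Complex lim)
  show "(\<lambda>n. \<phi> (X n)) \<longlonglongrightarrow> \<phi> T"
    unfolding \<phi>
    by (rule tannerys_theorem[THEN conjunct2, THEN conjunct2, OF limc _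
        summable_mult[OF summable_norm_product[OF sm], of "2 * C"]])
       (auto intro!: always_eventually simp: cmod_cinner_blinfun_le[OF X(2)])
qed (use X in simp)

lemma closedin_weak_star_bounded:
  assumes "closedin weak_star_topology Y" "T \<in> BH" "\<And>n. X n \<in> Y" "\<And>n::nat. norm (X n) \<le> C"
    and "\<And>x y. (\<lambda>n. inner (blinfun_apply (X n) x) y) \<longlonglongrightarrow> inner (blinfun_apply T x) y"
  shows "T \<in> Y"
proof -
  have "X n \<in> BH" for n
    using closedin_subset[OF assms(1)] assms(3) by auto
  from limitin_closedin[OF limitin_weak_star_bounded[OF assms(2) this assms(4,5)] assms(1)]
  show ?thesis using assms(3) by simp
qed

text \<open>A norm convergent sequence is bounded and converges weakly, and its limit stays
  complex-linear. This lets norm approximation prove membership in a weak* closed space.\<close>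

lemma closedin_weak_star_closed:
  assumes Y: "closedin weak_star_topology Y"
  shows "closed Y"
  unfolding closed_sequential_limits
proof (intro allI impI, elim conjE)
  fix X T assume X: "\<forall>n::nat. X n \<in> Y" and lim: "X \<longlonglongrightarrow> T"
  have YBH: "Y \<subseteq> BH" using closedin_subset[OF Y] by simp
  have lim_apply: "(\<lambda>n. blinfun_apply (X n) x) \<longlonglongrightarrow> blinfun_apply T x" for x
    using lim by (intro tendsto_intros)
  obtain C where C: "\<And>n. norm (X n) \<le> C"
    using convergent_imp_Bseq[OF convergentI[OF lim]] unfolding Bseq_def by blast
  have "T \<in> BH"
    unfolding BH_def
  proof (intro CollectI allI)
    fix c x
    have "(\<lambda>n. c *\<^sub>C blinfun_apply (X n) x) \<longlonglongrightarrow> c *\<^sub>C blinfun_apply T x"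
      by (rule bounded_linear.tendsto[OF bounded_linear_scaleC lim_apply])
    moreover have "(\<lambda>n. c *\<^sub>C blinfun_apply (X n) x) = (\<lambda>n. blinfun_apply (X n) (c *\<^sub>C x))"
      using X YBH BH_scaleC by (metis subsetD)
    ultimately show "blinfun_apply T (c *\<^sub>C x) = c *\<^sub>C blinfun_apply T x"
      using LIMSEQ_unique[OF lim_apply[of "c *\<^sub>C x"]] by simp
  qed
  moreover have "(\<lambda>n. inner (blinfun_apply (X n) x) y) \<longlonglongrightarrow> inner (blinfun_apply T x) y" for x y
    by (rule tendsto_inner[OF lim_apply tendsto_const])
  ultimately show "T \<in> Y"
    using closedin_weak_star_bounded[OF Y, of T X C] X C by blast
qed

text \<open>The range is the fixed point set of \<open>\<Phi>\<close>. Weak* continuity gives the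
  coefficients of \<open>\<Phi> (X n)\<close> the limit given by \<open>\<Phi> T\<close>, while
  eventually \<open>\<Phi> (X n) = X n\<close>, so \<open>\<Phi> T = T\<close>.\<close>

lemma Ran_weak_limit:
  fixes X :: "nat \<Rightarrow> 'h::complex_hilbert_space \<Rightarrow>\<^sub>L 'h"
  assumes \<Phi>: "schur_idempotent D \<Phi>"
    and T: "T \<in> BH" and X: "\<And>n. X n \<in> BH" "\<And>n. norm (X n) \<le> C"
    and lim: "\<And>x y. (\<lambda>n. inner (blinfun_apply (X n) x) y) \<longlonglongrightarrow> inner (blinfun_apply T x) y"
    and ev: "\<forall>\<^sub>F n in sequentially. X n \<in> Ran \<Phi>"
  shows "T \<in> Ran \<Phi>"
proof -
  have limX: "limitin weak_star_topology X T sequentially"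
    by (rule limitin_weak_star_bounded[OF T X lim])
  have "blinfun_apply (\<Phi> T) x = blinfun_apply T x" for x
  proof -
    have "(\<lambda>n. cinner (blinfun_apply (\<Phi> (X n)) x) y) \<longlonglongrightarrow> cinner (blinfun_apply (\<Phi> T) x) y" for y
      using continuous_map_limit[OF continuous_map_compose[OF schur_idempotentD(5)[OF \<Phi>]
            continuous_predual_functional[OF vector_functional_predual]] limX]
      by (simp add: o_def)
    then have "(\<lambda>n. inner (blinfun_apply (\<Phi> (X n)) x) y) \<longlonglongrightarrow> inner (blinfun_apply (\<Phi> T) x) y" for y
      unfolding inner_eq_Re_cinner by (rule tendsto_Re)
    moreover have "\<forall>\<^sub>F n in sequentially. \<Phi> (X n) = X n"
      using ev by eventually_elim (simp add: mem_Ran_iff[OF \<Phi>])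
    then have "\<forall>\<^sub>F n in sequentially. inner (blinfun_apply (\<Phi> (X n)) x) y = inner (blinfun_apply (X n) x) y" for y
      by eventually_elim simp
    ultimately have "(\<lambda>n. inner (blinfun_apply (X n) x) y) \<longlonglongrightarrow> inner (blinfun_apply (\<Phi> T) x) y" for y
      using tendsto_cong by fast
    then have "inner (blinfun_apply (\<Phi> T) x) y = inner (blinfun_apply T x) y" for y
      using LIMSEQ_unique[OF _ lim] by blast
    then have "inner (blinfun_apply (\<Phi> T) x - blinfun_apply T x) y = 0" for y
      by (simp add: inner_diff_left)
    then show ?thesis
      by (metis inner_eq_zero_iff right_minus_eq)
  qed
  then show ?thesis
    using T by (auto simp: mem_Ran_iff[OF \<Phi>] intro: blinfun_eqI)
qed

section \<open>Weak limits of bounded sequences of operators\<close>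

lemma norm_weak_limit_le:
  fixes X :: "nat \<Rightarrow> 'h::real_inner \<Rightarrow>\<^sub>L 'h"
  assumes lim: "\<And>x y. (\<lambda>n. inner (blinfun_apply (X n) x) y) \<longlonglongrightarrow> inner (blinfun_apply T x) y"
    and X: "\<And>n. norm (X n) \<le> b n" and b: "b \<longlonglongrightarrow> c"
  shows "norm T \<le> c"
proof (rule norm_blinfun_bound)
  have "0 \<le> b n" for n
    using X[of n] norm_ge_zero order_trans by blast
  then show "0 \<le> c"
    using b by (intro LIMSEQ_le_const[OF b]) auto
  fix x
  \<comment> \<open>Lower semicontinuity of the norm: testing against \<open>T x\<close> itself
    makes the limiting coefficient the square of \<open>norm (T x)\<close>.\<close>
  define z where "z = blinfun_apply T x"
  have "inner (blinfun_apply (X n) x) z \<le> b n * norm x * norm z" for n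
    using abs_inner_blinfun_le[OF X, of n x z] by linarith
  moreover have "(\<lambda>n. b n * norm x * norm z) \<longlonglongrightarrow> c * norm x * norm z"
    by (intro tendsto_intros b)
  ultimately have "inner z z \<le> c * norm x * norm z"
    using LIMSEQ_le[OF lim[of x z]] unfolding z_def by blast
  then have "norm z * norm z \<le> (c * norm x) * norm z"
    by (simp add: power2_norm_eq_inner[symmetric] power2_eq_square)
  then show "norm (blinfun_apply T x) \<le> c * norm x"
    using \<open>0 \<le> c\<close> unfolding z_def[symmetric]
    by (cases "norm z = 0") (simp_all add: mult_le_cancel_right)
qed

text \<open>Uniform boundedness makes the forms equicontinuous near each pair of vectors, so the
  Cauchy property passes from dense pairs to all pairs.\<close>

lemma convergent_bounded_forms_dense:
  fixes B :: "nat \<Rightarrow> 'a::real_inner \<Rightarrow>\<^sub>L 'a"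
  assumes E: "closure E = UNIV" and B: "\<And>n. norm (B n) \<le> C"
    and conv: "\<And>u v. u \<in> E \<Longrightarrow> v \<in> E \<Longrightarrow> convergent (\<lambda>n. inner (blinfun_apply (B n) u) v)"
  shows "convergent (\<lambda>n. inner (blinfun_apply (B n) x) y)"
proof -
  have C0: "0 \<le> C"
    using B[of 0] norm_ge_zero order_trans by blast
  note bound = abs_inner_blinfun_le[OF B]
  have "Cauchy (\<lambda>n. inner (blinfun_apply (B n) x) y)"
  proof (rule metric_CauchyI)
    fix e :: real assume "0 < e"
    \<comment> \<open>The second bound keeps the error of replacing \<open>x\<close>,
      \<open>y\<close> by \<open>u\<close>, \<open>v\<close> at most \<open>e / 4\<close>; the bound
      1 gives \<open>norm u \<le> norm x + 1\<close>.\<close>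
    define d where "d = min 1 (e / (4 * (C + 1) * (norm x + norm y + 1)))"
    have K: "0 < 4 * (C + 1) * (norm x + norm y + 1)"
      using C0 by (intro mult_pos_pos add_nonneg_pos) auto
    then have d: "0 < d"
      using \<open>0 < e\<close> by (simp add: d_def)
    have "d \<le> e / (4 * (C + 1) * (norm x + norm y + 1))"
      by (simp add: d_def)
    then have "d * (4 * (C + 1) * (norm x + norm y + 1)) \<le> e"
      using K by (simp only: pos_le_divide_eq)
    then have de: "4 * ((C + 1) * d * (norm x + norm y + 1)) \<le> e"
      by (simp only: ac_simps)
    obtain u where u: "u \<in> E" "norm (x - u) < d"
      using E d closure_approachable[of x E] by (auto simp: dist_norm norm_minus_commute)
    obtain v where v: "v \<in> E" "norm (y - v) < d"
      using E d closure_approachable[of y E] by (auto simp: dist_norm norm_minus_commute)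
    \<comment> \<open>The extra \<open>e / 8\<close> makes the inequality strict; two such errors
      and the Cauchy error \<open>e / 4\<close> add up to exactly \<open>e\<close>.\<close>
    have approx: "\<bar>inner (blinfun_apply (B n) x) y - inner (blinfun_apply (B n) u) v\<bar> < e / 4 + e / 8" for n
    proof -
      have nu: "norm u \<le> norm x + 1"
        using u(2) norm_triangle_ineq2[of u x] by (simp add: d_def norm_minus_commute)
      have "inner (blinfun_apply (B n) x) y - inner (blinfun_apply (B n) u) v =
          inner (blinfun_apply (B n) (x - u)) y + inner (blinfun_apply (B n) u) (y - v)"
        by (simp add: blinfun.diff_right inner_diff_left inner_diff_right)
      also have "\<bar>\<dots>\<bar> \<le> C * norm (x - u) * norm y + C * norm u * norm (y - v)"
        using bound[of n "x - u" y] bound[of n u "y - v"] by linarith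
      also have "\<dots> \<le> C * d * norm y + C * (norm x + 1) * d"
        using u(2) v(2) nu C0 d by (intro add_mono mult_mono) auto
      also have "\<dots> = C * d * (norm x + norm y + 1)"
        by (simp add: algebra_simps)
      also have "\<dots> \<le> (C + 1) * d * (norm x + norm y + 1)"
        using d by (intro mult_right_mono) auto
      also have "\<dots> \<le> e / 4" using de by simp
      finally show ?thesis using \<open>0 < e\<close> by linarith
    qed
    have "Cauchy (\<lambda>n. inner (blinfun_apply (B n) u) v)"
      using conv[OF u(1) v(1)] by (rule convergent_Cauchy)
    then obtain N where N: "\<And>i j. N \<le> i \<Longrightarrow> N \<le> j \<Longrightarrow>
        dist (inner (blinfun_apply (B i) u) v) (inner (blinfun_apply (B j) u) v) < e / 4"
      using metric_CauchyD[of _ "e / 4"] \<open>0 < e\<close> by (metis divide_pos_pos zero_less_numeral)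
    have "dist (inner (blinfun_apply (B i) x) y) (inner (blinfun_apply (B j) x) y) < e"
      if "N \<le> i" "N \<le> j" for i j
      using N[OF that] approx[of i] approx[of j] unfolding dist_real_def by linarith
    then show "\<exists>N. \<forall>i\<ge>N. \<forall>j\<ge>N. dist (inner (blinfun_apply (B i) x) y) (inner (blinfun_apply (B j) x) y) < e"
      by blast
  qed
  then show ?thesis by (rule Cauchy_convergent)
qed

text \<open>For fixed \<open>x\<close> the limit form is a bounded real-linear functional of
  \<open>y\<close>, so Riesz provides \<open>T x\<close>. Complex linearity passes to the limit by
  moving the scalar into the second argument.\<close>

lemma weak_limit_exists:
  fixes X :: "nat \<Rightarrow> 'h::complex_hilbert_space \<Rightarrow>\<^sub>L 'h"
  assumes X: "\<And>n. X n \<in> BH" "\<And>n. norm (X n) \<le> C"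
    and conv: "\<And>x y. convergent (\<lambda>n. inner (blinfun_apply (X n) x) y)"
  obtains T where "T \<in> BH"
    "\<And>x y. (\<lambda>n. inner (blinfun_apply (X n) x) y) \<longlonglongrightarrow> inner (blinfun_apply T x) y"
proof -
  define L where "L x y = lim (\<lambda>n. inner (blinfun_apply (X n) x) y)" for x y
  have L: "(\<lambda>n. inner (blinfun_apply (X n) x) y) \<longlonglongrightarrow> L x y" for x y
    using conv unfolding L_def convergent_LIMSEQ_iff .
  have L_eqI: "L x y = l" if "(\<lambda>n. inner (blinfun_apply (X n) x) y) \<longlonglongrightarrow> l" for x y l
    using LIMSEQ_unique[OF L that] .
  have L_bound: "\<bar>L x y\<bar> \<le> C * norm x * norm y" for x y
    using abs_inner_blinfun_le[OF X(2)] by (intro LIMSEQ_le_const2[OF tendsto_rabs[OF L]]) blast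
  have "\<exists>p. \<forall>y. inner p y = L x y" for x
  proof (rule Riesz_closed_subspace[of UNIV "L x" "C * norm x"])
    show "L x (y + z) = L x y + L x z" for y z
      by (rule L_eqI) (unfold inner_add_right, intro tendsto_add L)
    show "L x (c *\<^sub>R y) = c * L x y" for c y
      by (rule L_eqI) (unfold inner_scaleR_right, intro tendsto_mult tendsto_const L)
  qed (use L_bound in auto)
  then obtain T where "\<forall>x y. inner (T x) y = L x y"
    using choice[of "\<lambda>x p. \<forall>y. inner p y = L x y"] by blast
  then have T: "inner (T x) y = L x y" for x y
    by blast
  have T_eqI: "T x = p" if "\<And>y. (\<lambda>n. inner (blinfun_apply (X n) x) y) \<longlonglongrightarrow> inner p y" for x p
  proof -
    have "inner (T x - p) (T x - p) = 0"
      using L_eqI[OF that] T by (simp add: inner_diff_left)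
    then show ?thesis by simp
  qed
  have T_add: "T (x + z) = T x + T z" for x z
    by (rule T_eqI)
       (unfold blinfun.add_right inner_add_left T, intro tendsto_add L)
  have T_scaleC: "T (c *\<^sub>C x) = c *\<^sub>C T x" for c x
    by (rule T_eqI) (unfold X(1)[THEN BH_scaleC] inner_scaleC_left T, rule L)
  have T_norm: "norm (T x) \<le> norm x * C" for x
  proof -
    have "norm (T x) * norm (T x) \<le> (norm x * C) * norm (T x)"
      using L_bound[of x "T x"] T[of x "T x"]
      by (simp add: power2_norm_eq_inner[symmetric] power2_eq_square mult.commute)
    moreover have "0 \<le> C"
      using X(2)[of 0] norm_ge_zero order_trans by blast
    ultimately show ?thesis
      by (cases "norm (T x) = 0") (simp_all add: mult_le_cancel_right)
  qed
  have bl: "bounded_linear T"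
    by (rule bounded_linear_intro[where K = C]) (simp_all only: T_add scaleR_scaleC T_scaleC T_norm)
  show thesis
  proof
    show "Blinfun T \<in> BH"
      by (simp add: BH_def bounded_linear_Blinfun_apply[OF bl] T_scaleC)
    show "(\<lambda>n. inner (blinfun_apply (X n) x) y) \<longlonglongrightarrow> inner (blinfun_apply (Blinfun T) x) y" for x y
      using L by (simp add: bounded_linear_Blinfun_apply[OF bl] T)
  qed
qed

text \<open>Separability allows a diagonal subsequence whose coefficients converge on a countable
  dense set of pairs; boundedness extends convergence to all pairs.\<close>

lemma weakly_convergent_subsequence:
  fixes X :: "nat \<Rightarrow> 'h::complex_hilbert_space \<Rightarrow>\<^sub>L 'h"
  assumes sep: "separable_space (euclidean :: 'h topology)"
    and X: "\<And>n. X n \<in> BH" "\<And>n. norm (X n) \<le> C"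
  obtains r T where "strict_mono (r :: nat \<Rightarrow> nat)" "T \<in> BH"
    "\<And>x y. (\<lambda>n. inner (blinfun_apply (X (r n)) x) y) \<longlonglongrightarrow> inner (blinfun_apply T x) y"
proof -
  obtain E :: "'h set" where E: "countable E" "closure E = UNIV"
    using sep unfolding separable_space_def by auto
  \<comment> \<open>The diagonal argument asks for one bound valid at all pairs. Dividing by this
    weight provides it, and the summand 1 keeps the weight positive.\<close>
  define w where "w p = 1 + norm (fst p) * norm (snd p)" for p :: "'h \<times> 'h"
  have w: "0 < w p" for p
    unfolding w_def by (intro add_pos_nonneg) auto
  define f where "f n p = inner (blinfun_apply (X n) (fst p)) (snd p) / w p" for n p
  have f_bound: "norm (f n p) \<le> C" for n p
  proof -
    have C0: "0 \<le> C"
      using X(2)[of 0] norm_ge_zero order_trans by blast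
    have "\<bar>inner (blinfun_apply (X n) (fst p)) (snd p)\<bar> \<le> C * w p"
      using abs_inner_blinfun_le[OF X(2)[of n], of "fst p" "snd p"] C0
      by (simp add: w_def algebra_simps)
    then show ?thesis
      using w[of p] by (simp add: f_def pos_divide_le_eq)
  qed
  have "countable (E \<times> E)"
    using E(1) by simp
  then obtain r where r: "strict_mono r" "\<And>p. p \<in> E \<times> E \<Longrightarrow> \<exists>l. (\<lambda>n. f (r n) p) \<longlonglongrightarrow> l"
    using function_convergent_subsequence[of "E \<times> E" f C] f_bound by metis
  have "convergent (\<lambda>n. inner (blinfun_apply (X (r n)) u) v)" if uv: "u \<in> E" "v \<in> E" for u v
  proof -
    obtain l where "(\<lambda>n. f (r n) (u, v)) \<longlonglongrightarrow> l"
      using r(2)[of "(u, v)"] uv by auto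
    then have "(\<lambda>n. w (u, v) * f (r n) (u, v)) \<longlonglongrightarrow> w (u, v) * l"
      by (rule tendsto_mult_left)
    moreover have "w (u, v) * f n (u, v) = inner (blinfun_apply (X n) u) v" for n
      using w[of "(u, v)"] by (simp add: f_def)
    ultimately show ?thesis by (auto simp: convergent_def)
  qed
  then have "convergent (\<lambda>n. inner (blinfun_apply (X (r n)) x) y)" for x y
    using convergent_bounded_forms_dense[OF E(2), of "\<lambda>n. X (r n)" C] X(2) by blast
  then obtain T where "T \<in> BH"
    "\<And>x y. (\<lambda>n. inner (blinfun_apply (X (r n)) x) y) \<longlonglongrightarrow> inner (blinfun_apply T x) y"
    using weak_limit_exists[of "\<lambda>n. X (r n)" C] X by blast
  with r(1) that show thesis by blast
qed

subsection \<open>Sums of bimodules\<close>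

text \<open>On a generating set the condition reads
  \<open>\<phi> T - \<phi> (\<Phi> T) \<in> G\<close>, and the left side is a difference of
  continuous functions.\<close>

lemma continuous_map_perp:
  fixes D :: "('h::complex_hilbert_space \<Rightarrow>\<^sub>L 'h) set"
  assumes \<Phi>: "schur_idempotent D \<Phi>"
  shows "continuous_map weak_star_topology weak_star_topology (map_perp \<Phi>)"
proof -
  define B where "B = {{T \<in> (BH :: ('h \<Rightarrow>\<^sub>L 'h) set). \<phi> T \<in> G} | \<phi> G. \<phi> \<in> predual_functionals \<and> open G}"
  have top: "weak_star_topology = topology_generated_by B"
    by (simp add: weak_star_topology_def B_def)
  have maps: "map_perp \<Phi> T \<in> BH" if "T \<in> BH" for T
    by (rule map_perp_BH[OF \<Phi> that])
  have "continuous_map weak_star_topology (topology_generated_by B) (map_perp \<Phi>)"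
  proof (rule continuous_on_generated_topo)
    fix N assume "N \<in> B"
    then obtain \<phi> G where N: "N = {T \<in> BH. \<phi> T \<in> G}" "\<phi> \<in> predual_functionals" "open G"
      unfolding B_def by blast
    have "continuous_map weak_star_topology euclidean (\<lambda>T. \<phi> T - \<phi> (\<Phi> T))"
      using continuous_map_compose[OF schur_idempotentD(5)[OF \<Phi>] continuous_predual_functional[OF N(2)]]
      by (intro continuous_map_diff continuous_predual_functional[OF N(2)]) (simp add: o_def)
    then have "openin weak_star_topology {T \<in> topspace weak_star_topology. \<phi> T - \<phi> (\<Phi> T) \<in> G}"
      by (rule openin_continuous_map_preimage) (simp add: N(3))
    also have "{T \<in> topspace weak_star_topology. \<phi> T - \<phi> (\<Phi> T) \<in> G} =
        map_perp \<Phi> -` N \<inter> topspace weak_star_topology"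
      using maps by (auto simp: N(1) map_perp_def predual_functionals_diff[OF N(2)])
    finally show "openin weak_star_topology (map_perp \<Phi> -` N \<inter> topspace weak_star_topology)" .
  next
    have "\<Union>B = BH"
      by (metis top topspace_weak_star topology_generated_by_topspace)
    then show "map_perp \<Phi> ` topspace weak_star_topology \<subseteq> \<Union>B"
      using maps by auto
  qed
  then show ?thesis
    by (simp only: top)
qed

lemma uniformly_bounded_orbit:
  fixes \<Phi> :: "nat \<Rightarrow> ('h::complex_hilbert_space \<Rightarrow>\<^sub>L 'h) \<Rightarrow> ('h \<Rightarrow>\<^sub>L 'h)"
  assumes \<Phi>: "\<And>n. schur_idempotent D (\<Phi> n)"
    and bound: "(SUP n. map_norm (\<Phi> n)) < \<infinity>" and T: "T \<in> BH"
  obtains C where "\<And>n. norm (\<Phi> n T) \<le> C"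
proof -
  define M where "M = enn2real (SUP n. map_norm (\<Phi> n))"
  have unit: "norm (\<Phi> n S) \<le> M" if "S \<in> BH" "norm S \<le> 1" for n S
  proof -
    have "ennreal (norm (\<Phi> n S)) \<le> map_norm (\<Phi> n)"
      unfolding map_norm_def using that by (intro SUP_upper) auto
    also have "\<dots> \<le> (SUP n. map_norm (\<Phi> n))"
      by (rule SUP_upper) simp
    also have "\<dots> = ennreal M"
      unfolding M_def using bound by (intro ennreal_enn2real[symmetric]) (simp only: infinity_ennreal_def)
    finally show ?thesis
      by (simp add: M_def ennreal_le_iff)
  qed
  \<comment> \<open>This scales \<open>T\<close> into the unit ball; the added 1 also covers
    \<open>T = 0\<close>.\<close>
  define c where "c = 1 / (norm T + 1)"
  have c: "0 < c" "norm T * c \<le> 1"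
    using norm_ge_zero[of T] by (simp_all add: c_def add_nonneg_pos pos_divide_le_eq)
  have "norm (\<Phi> n T) \<le> M / c" for n
  proof -
    have "\<Phi> n (c *\<^sub>R T) = c *\<^sub>R \<Phi> n T"
      unfolding scaleR_scaleC by (rule schur_idempotentD(3)[OF \<Phi> T])
    moreover have "c *\<^sub>R T \<in> BH"
      unfolding scaleR_scaleC by (rule complex_vector.subspace_scale[OF csubspace_BH T])
    ultimately have "c * norm (\<Phi> n T) \<le> M"
      using unit[of "c *\<^sub>R T" n] c by (simp add: mult.commute)
    then show ?thesis
      using c(1) by (simp add: pos_le_divide_eq mult.commute)
  qed
  with that show thesis by blast
qed

text \<open>Write \<open>T\<close> as \<open>\<Phi> n T + S n\<close> plus an error of norm at most
  \<open>b n\<close>. Nested subsequences make both summands converge weakly, and lower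
  semicontinuity bounds the limiting error by \<open>c\<close> itself, with no loss.\<close>

lemma approximate_decomposition_limit:
  fixes T :: "'h::complex_hilbert_space \<Rightarrow>\<^sub>L 'h"
  assumes sep: "separable_space (euclidean :: 'h topology)"
    and \<Phi>: "\<And>n. schur_idempotent D (\<Phi> n)" "(SUP n. map_norm (\<Phi> n)) < \<infinity>"
      "decseq (\<lambda>n. Ran (\<Phi> n))"
    and U: "closedin weak_star_topology U" and T: "T \<in> BH"
    and S: "\<And>n. S n \<in> U" "\<And>n. norm (map_perp (\<Phi> n) T - S n) \<le> b n" and b: "b \<longlonglongrightarrow> c"
  shows "\<exists>Y\<in>U. \<exists>Z\<in>\<Inter>n. Ran (\<Phi> n). norm (T - (Y + Z)) \<le> c"
proof -
  have UBH: "U \<subseteq> BH" using closedin_subset[OF U] by simp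
  obtain C where C: "\<And>n. norm (\<Phi> n T) \<le> C"
    using uniformly_bounded_orbit[OF \<Phi>(1,2) T] by blast
  have \<Phi>T: "\<Phi> n T \<in> BH" for n
    by (rule schur_idempotentD(1)[OF \<Phi>(1) T])
  have SBH: "S n \<in> BH" for n
    using S(1) UBH by blast
  obtain r Z where r: "strict_mono (r :: nat \<Rightarrow> nat)" and Z: "Z \<in> BH"
    "\<And>x y. (\<lambda>n. inner (blinfun_apply (\<Phi> (r n) T) x) y) \<longlonglongrightarrow> inner (blinfun_apply Z x) y"
    using weakly_convergent_subsequence[OF sep, of "\<lambda>n. \<Phi> n T" C] \<Phi>T C by metis
  obtain B where B: "\<And>n. b n \<le> B"
    using convergent_imp_bounded[OF b] unfolding bounded_iff
    by (metis abs_le_D1 rangeI real_norm_def)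
  have S_bound: "norm (S n) \<le> norm T + C + B" for n
  proof -
    have "S n = T - \<Phi> n T - (map_perp (\<Phi> n) T - S n)"
      by (simp add: map_perp_def)
    then have "norm (S n) \<le> norm (T - \<Phi> n T) + norm (map_perp (\<Phi> n) T - S n)"
      by (metis norm_triangle_ineq4)
    moreover have "norm (T - \<Phi> n T) \<le> norm T + norm (\<Phi> n T)"
      by (rule norm_triangle_ineq4)
    ultimately show ?thesis
      using C[of n] S(2)[of n] B[of n] by linarith
  qed
  obtain s Y where s: "strict_mono (s :: nat \<Rightarrow> nat)" and Y: "Y \<in> BH"
    "\<And>x y. (\<lambda>n. inner (blinfun_apply (S (r (s n))) x) y) \<longlonglongrightarrow> inner (blinfun_apply Y x) y"
    using weakly_convergent_subsequence[OF sep, of "\<lambda>n. S (r n)" "norm T + C + B"] SBH S_bound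
    by metis
  have Z': "(\<lambda>n. inner (blinfun_apply (\<Phi> (r (s n)) T) x) y) \<longlonglongrightarrow> inner (blinfun_apply Z x) y" for x y
    using LIMSEQ_subseq_LIMSEQ[OF Z(2) s] by (simp add: o_def)
  have rs: "n \<le> r (s n)" for n
    using seq_suble[OF r, of "s n"] seq_suble[OF s, of n] by linarith
  have "Y \<in> U"
    by (rule closedin_weak_star_bounded[OF U Y(1) S(1) S_bound Y(2)])
  moreover have "Z \<in> Ran (\<Phi> m)" for m
  proof (rule Ran_weak_limit[OF \<Phi>(1) Z(1) \<Phi>T C Z'])
    \<comment> \<open>The ranges decrease and \<open>m \<le> n \<le> r (s n)\<close>, so the tail
      lies in \<open>Ran (\<Phi> m)\<close>.\<close>
    have "\<Phi> (r (s n)) T \<in> Ran (\<Phi> m)" if "m \<le> n" for n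
    proof -
      have "Ran (\<Phi> (r (s n))) \<subseteq> Ran (\<Phi> m)"
        using decseqD[OF \<Phi>(3)] that rs[of n] order_trans by blast
      then show ?thesis
        using T by (auto simp: Ran_def)
    qed
    then show "\<forall>\<^sub>F n in sequentially. \<Phi> (r (s n)) T \<in> Ran (\<Phi> m)"
      by (rule eventually_sequentiallyI)
  qed
  moreover have "norm (T - (Y + Z)) \<le> c"
  proof (rule norm_weak_limit_le)
    let ?X = "\<lambda>n. map_perp (\<Phi> (r (s n))) T - S (r (s n))"
    show "norm (?X n) \<le> b (r (s n))" for n
      by (rule S(2))
    have "strict_mono (r \<circ> s)"
      using r s by (rule strict_mono_o)
    then show "(\<lambda>n. b (r (s n))) \<longlonglongrightarrow> c"
      using LIMSEQ_subseq_LIMSEQ[OF b] by (simp add: o_def)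
    fix x y
    have "(\<lambda>n. inner (blinfun_apply T x) y - inner (blinfun_apply (\<Phi> (r (s n)) T) x) y
        - inner (blinfun_apply (S (r (s n))) x) y) \<longlonglongrightarrow>
      inner (blinfun_apply T x) y - inner (blinfun_apply Z x) y - inner (blinfun_apply Y x) y"
      by (intro tendsto_diff tendsto_const Z' Y(2))
    then show "(\<lambda>n. inner (blinfun_apply (?X n) x) y) \<longlonglongrightarrow> inner (blinfun_apply (T - (Y + Z)) x) y"
      by (simp add: map_perp_def blinfun.diff_left blinfun.add_left inner_diff_left inner_add_left
          algebra_simps)
  qed
  ultimately show ?thesis by blast
qed

text \<open>Transfers an estimate valid for every admissible constant to their infimum. The case
  \<open>a = 0\<close> is separate because the argument divides by \<open>a\<close>.\<close>

lemma le_Inf_mult: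
  fixes a x :: real
  assumes "A \<noteq> {}" "0 \<le> a" "\<And>l. l \<in> A \<Longrightarrow> x \<le> l * a"
  shows "x \<le> Inf A * a"
proof (cases "a = 0")
  case True
  then show ?thesis using assms(1,3) by auto
next
  case False
  then have "0 < a" using assms(2) by simp
  then have "x / a \<le> Inf A"
    using assms(1,3) by (intro cInf_greatest) (auto simp: pos_divide_le_eq)
  then show ?thesis using \<open>0 < a\<close> by (simp add: pos_divide_le_eq)
qed

text \<open>Both claims come from the decomposition limit: with error 0 it describes
  \<open>W\<close> by weak* closed conditions, and with error \<open>c\<close> it gives the distance
  estimate.\<close>

lemma approximately_injective_sum:
  fixes D U V :: "('h::complex_hilbert_space \<Rightarrow>\<^sub>L 'h) set"
  assumes sep: "separable_space (euclidean :: 'h topology)" and D: "masa D"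
    and \<Phi>: "\<Phi> \<in> H_injective_sequences D V"
    and U: "masa_bimodule D U" "hyperreflexive U"
  defines "W \<equiv> {S + T | S T. S \<in> U \<and> T \<in> V}"
  shows "weak_star_closed_subspace W"
    and "\<And>T. T \<in> BH \<Longrightarrow>
      op_dist T W \<le> hyperreflexivity_constant U * (SUP n. schur_lambda (\<Phi> n)) * arveson_dist T W"
proof -
  define k where "k = hyperreflexivity_constant U"
  define L where "L = (SUP n. schur_lambda (\<Phi> n))"
  have schur: "schur_idempotent D (\<Phi> n)" for n
    using \<Phi> by (simp add: H_injective_sequences_def decreases_to_def)
  have bounded: "(SUP n. map_norm (\<Phi> n)) < \<infinity>" and le: "schur_le (\<Phi> (Suc n)) (\<Phi> n)"
    and V: "V = (\<Inter>n. Ran (\<Phi> n))" for n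
    using \<Phi> by (simp_all add: H_injective_sequences_def decreases_to_def)
  have lam: "lambda_bounds (\<Phi> n) \<noteq> {}" and bdd: "bdd_above (range (\<lambda>n. schur_lambda (\<Phi> n)))" for n
    using \<Phi> by (simp_all add: H_injective_sequences_def schur_H_def)
  have Ran0: "0 \<in> Ran (\<Phi> n)" for n
    by (rule complex_vector.subspace_0[OF csubspace_Ran[OF schur]])
  have l0: "0 \<le> schur_lambda (\<Phi> n)" for n
    unfolding schur_lambda_def
    by (rule cInf_greatest[OF lam]) (simp add: lambda_bounds_def)
  \<comment> \<open>The inequality survives passage to the infimum of admissible constants, but
    their positivity may not; \<open>l0\<close> keeps nonnegativity.\<close>
  have l: "norm (map_perp (\<Phi> n) T) \<le> schur_lambda (\<Phi> n) * arveson_dist T (Ran (\<Phi> n))"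
    if "T \<in> BH" for n T
    unfolding schur_lambda_def
    using that by (intro le_Inf_mult lam arveson_dist_nonneg Ran0) (simp add: lambda_bounds_def)
  have L: "schur_lambda (\<Phi> n) \<le> L" for n
    unfolding L_def by (rule cSUP_upper[OF _ bdd]) simp
  have U_closed: "U \<subseteq> BH" "csubspace U" "closedin weak_star_topology U"
    and U_bimodule: "\<And>A S B. A \<in> D \<Longrightarrow> S \<in> U \<Longrightarrow> B \<in> D \<Longrightarrow> A o\<^sub>L S o\<^sub>L B \<in> U"
    using U(1) by (auto simp: masa_bimodule_def weak_star_closed_subspace_def)
  have U0: "0 \<in> U"
    by (rule complex_vector.subspace_0[OF U_closed(2)])
  have bounds: "hyperreflexivity_bounds U \<noteq> {}"
    using U(2) by (simp add: hyperreflexive_def)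
  have k0: "0 \<le> k"
    unfolding k_def hyperreflexivity_constant_def
    by (rule cInf_greatest[OF bounds]) (simp add: hyperreflexivity_bounds_def)
  have k: "op_dist T U \<le> k * arveson_dist T U" if "T \<in> BH" for T
    unfolding k_def hyperreflexivity_constant_def
    using that by (intro le_Inf_mult bounds arveson_dist_nonneg U0)
      (simp add: hyperreflexivity_bounds_def)
  have approx: "\<exists>S\<in>U. norm (T - S) < c" if "op_dist T U < c" for T c
    using cInf_lessD[OF _ that[unfolded op_dist_def]] U0 by auto
  \<comment> \<open>Hyperreflexivity makes the norm distance 0, so \<open>T\<close> lies in the norm
    closure of \<open>U\<close>, which is \<open>U\<close> because weak* closed sets are norm
    closed.\<close>
  have U_reflexive: "T \<in> U" if T: "T \<in> BH" "arveson_dist T U = 0" for T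
  proof -
    have "op_dist T U \<le> 0" using k[OF T(1)] T(2) by simp
    then have "\<exists>S\<in>U. norm (T - S) < e" if "0 < e" for e
      using that by (intro approx) simp
    then have "T \<in> closure U"
      by (auto simp: closure_approachable dist_norm norm_minus_commute)
    then show ?thesis
      using closedin_weak_star_closed[OF U_closed(3)] by (simp add: closure_closed)
  qed
  have perp_U: "map_perp (\<Phi> n) S \<in> U" if "S \<in> U" for n S
    by (rule map_perp_invariant[OF D schur l0 l U_closed(1,2) U_bimodule U_reflexive that])
  have "Ran (\<Phi> (Suc n)) \<subseteq> Ran (\<Phi> n)" for n
    by (rule Ran_subset_if_schur_le[OF D schur schur l l0 l le])
  then have dec: "decseq (\<lambda>n. Ran (\<Phi> n))"
    by (rule decseq_SucI)
  note decomposition = approximate_decomposition_limit[OF sep schur bounded dec U_closed(3)]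
  have V_sub: "csubspace V"
    unfolding V using csubspace_Ran[OF schur]
    by (auto simp: complex_vector.subspace_def)
  have V_BH: "V \<subseteq> BH"
    unfolding V using mem_Ran_iff[OF schur] by blast
  \<comment> \<open>Forwards, \<open>map_perp (\<Phi> n)\<close> kills \<open>V\<close> and
    preserves \<open>U\<close>. Backwards, take \<open>S n = map_perp (\<Phi> n) T\<close> and error
    0 in the decomposition limit.\<close>
  have W_eq: "W = {T \<in> BH. \<forall>n. map_perp (\<Phi> n) T \<in> U}"
  proof (intro equalityI subsetI)
    fix T assume "T \<in> W"
    then obtain S Z where T: "T = S + Z" "S \<in> U" "Z \<in> V"
      unfolding W_def by blast
    have BH: "S \<in> BH" "Z \<in> BH"
      using T(2,3) U_closed(1) V_BH by blast+
    have "map_perp (\<Phi> n) T = map_perp (\<Phi> n) S" for n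
      using map_perp_add[OF schur BH] map_perp_Ran[OF schur, of Z n] T(3) by (simp add: T(1) V)
    then show "T \<in> {T \<in> BH. \<forall>n. map_perp (\<Phi> n) T \<in> U}"
      using perp_U[OF T(2)] BH_add[OF BH] T(1) by simp
  next
    fix T assume T: "T \<in> {T \<in> BH. \<forall>n. map_perp (\<Phi> n) T \<in> U}"
    have "\<exists>Y\<in>U. \<exists>Z\<in>\<Inter>n. Ran (\<Phi> n). norm (T - (Y + Z)) \<le> 0"
      by (rule decomposition[of T "\<lambda>n. map_perp (\<Phi> n) T" "\<lambda>_. 0"]) (use T in auto)
    then obtain Y Z where "Y \<in> U" "Z \<in> V" "T = Y + Z"
      unfolding V by auto
    then show "T \<in> W"
      unfolding W_def by blast
  qed
  have W_sub: "csubspace W"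
    unfolding W_def by (rule complex_vector.subspace_sums[OF U_closed(2) V_sub])
  have "W = BH \<inter> (\<Inter>n. {T \<in> topspace weak_star_topology. map_perp (\<Phi> n) T \<in> U})"
    unfolding W_eq by auto
  moreover have "closedin weak_star_topology
      (BH \<inter> (\<Inter>n. {T \<in> topspace weak_star_topology. map_perp (\<Phi> n) T \<in> U}))"
    using closedin_topspace[of "weak_star_topology :: ('h \<Rightarrow>\<^sub>L 'h) topology"]
    by (intro closedin_Int closedin_INT closedin_continuous_map_preimage[OF continuous_map_perp[OF schur]]
        U_closed(3)) auto
  ultimately show "weak_star_closed_subspace W"
    unfolding weak_star_closed_subspace_def using W_sub W_eq by auto
  fix T :: "'h \<Rightarrow>\<^sub>L 'h" assume T: "T \<in> BH"
  have W0: "0 \<in> W"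
    by (rule complex_vector.subspace_0[OF W_sub])
  define c where "c = k * L * arveson_dist T W"
  \<comment> \<open>The slack \<open>1 / real (Suc n)\<close> is there because the distance to
    \<open>U\<close> is an infimum; it vanishes in the limit.\<close>
  have "\<exists>S\<in>U. norm (map_perp (\<Phi> n) T - S) < c + 1 / real (Suc n)" for n
  proof (rule approx)
    have perp: "map_perp (\<Phi> n) T \<in> BH"
      by (rule map_perp_BH[OF schur T])
    \<comment> \<open>\<open>V\<close> lies in every \<open>Ran (\<Phi> n)\<close>, so the estimate
      for \<open>map_perp\<close> applies to \<open>W\<close> with constants bounded by
      \<open>L\<close>.\<close>
    have sub: "W \<subseteq> {S + R | S R. S \<in> U \<and> R \<in> Ran (\<Phi> n)}"
      unfolding W_def V by blast
    have "op_dist (map_perp (\<Phi> n) T) U \<le> k * arveson_dist (map_perp (\<Phi> n) T) U"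
      by (rule k[OF perp])
    also have "\<dots> \<le> k * (schur_lambda (\<Phi> n) * arveson_dist T W)"
      by (intro mult_left_mono k0 arveson_dist_map_perp_le[OF D schur l0 l U_closed(1,2) U_bimodule W0 sub T])
    also have "\<dots> \<le> k * (L * arveson_dist T W)"
      by (intro mult_left_mono mult_right_mono L k0 arveson_dist_nonneg W0)
    also have "\<dots> < c + 1 / real (Suc n)"
      by (simp add: c_def)
    finally show "op_dist (map_perp (\<Phi> n) T) U < c + 1 / real (Suc n)" .
  qed
  then obtain S where S: "\<And>n. S n \<in> U" "\<And>n. norm (map_perp (\<Phi> n) T - S n) < c + 1 / real (Suc n)"
    by metis
  have "(\<lambda>n. c + 1 / real (Suc n)) \<longlonglongrightarrow> c + 0"
    using LIMSEQ_inverse_real_of_nat by (intro tendsto_intros) (simp add: inverse_eq_divide)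
  then have "\<exists>Y\<in>U. \<exists>Z\<in>\<Inter>n. Ran (\<Phi> n). norm (T - (Y + Z)) \<le> c"
    by (intro decomposition[OF T S(1) less_imp_le[OF S(2)]]) simp
  then obtain Y Z where YZ: "Y \<in> U" "Z \<in> V" "norm (T - (Y + Z)) \<le> c"
    unfolding V by blast
  have "Y + Z \<in> W"
    unfolding W_def using YZ(1,2) by blast
  then have "op_dist T W \<le> norm (T - (Y + Z))"
    unfolding op_dist_def by (rule norm_INF_lower)
  also note YZ(3)
  finally show "op_dist T W \<le> hyperreflexivity_constant U * (SUP n. schur_lambda (\<Phi> n)) * arveson_dist T W"
    unfolding c_def k_def L_def .
qed

theorem theorem4p5:
  fixes D U V :: "('h::complex_hilbert_space \<Rightarrow>\<^sub>L 'h) set"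
  assumes "separable_space (euclidean :: 'h topology)"
    and "masa D"
    and "approx_H_injective D V"
    and "masa_bimodule D U" and "hyperreflexive U"
  shows "hyperreflexive {S + T | S T. S \<in> U \<and> T \<in> V} \<and>
    hyperreflexivity_constant {S + T | S T. S \<in> U \<and> T \<in> V}
      \<le> hyperreflexivity_constant U * lambda_H D V"
proof -
  define W where "W = {S + T | S T. S \<in> U \<and> T \<in> V}"
  define k where "k = hyperreflexivity_constant U"
  define L where "L \<Phi> = (SUP n. schur_lambda (\<Phi> n))" for \<Phi> :: "nat \<Rightarrow> ('h \<Rightarrow>\<^sub>L 'h) \<Rightarrow> ('h \<Rightarrow>\<^sub>L 'h)"
  have ne: "H_injective_sequences D V \<noteq> {}"
    using assms(3) by (simp add: approx_H_injective_def)
  have W: "weak_star_closed_subspace W" "\<And>T. T \<in> BH \<Longrightarrow> op_dist T W \<le> k * L \<Phi> * arveson_dist T W"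
    if "\<Phi> \<in> H_injective_sequences D V" for \<Phi>
    unfolding W_def k_def L_def
    using approximately_injective_sum[OF assms(1,2) that assms(4,5)] by blast+
  have W_closed: "weak_star_closed_subspace W"
    using W(1) ne by blast
  then have W0: "0 \<in> W"
    unfolding weak_star_closed_subspace_def by (blast intro: complex_vector.subspace_0)
  have mem: "l \<in> hyperreflexivity_bounds W"
    if "\<Phi> \<in> H_injective_sequences D V" "0 < l" "k * L \<Phi> \<le> l" for \<Phi> l
    unfolding hyperreflexivity_bounds_def
    using that W(2)[OF that(1)] mult_right_mono[OF that(3) arveson_dist_nonneg[OF W0]]
    by (blast intro: order_trans)
  have "hyperreflexivity_bounds W \<noteq> {}"
  proof -
    obtain \<Phi> where "\<Phi> \<in> H_injective_sequences D V" using ne by blast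
    \<comment> \<open>Admissible constants must be positive, whereas \<open>k * L \<Phi>\<close> may
      be 0.\<close>
    then have "max 1 (k * L \<Phi>) \<in> hyperreflexivity_bounds W"
      by (rule mem) simp_all
    then show ?thesis by blast
  qed
  then have "hyperreflexive W"
    using W_closed by (simp add: hyperreflexive_def)
  have k0: "0 \<le> k"
    unfolding k_def hyperreflexivity_constant_def using assms(5)
    by (intro cInf_greatest) (auto simp: hyperreflexive_def hyperreflexivity_bounds_def)
  \<comment> \<open>For the same reason the bound is reached through \<open>k * L \<Phi> + e\<close>
    with arbitrary positive \<open>e\<close>.\<close>
  have bound: "hyperreflexivity_constant W \<le> k * L \<Phi>" if \<Phi>: "\<Phi> \<in> H_injective_sequences D V" for \<Phi>
  proof (rule field_le_epsilon)
    fix e :: real assume e: "0 < e"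
    have "0 \<le> schur_lambda (\<Phi> 0)"
      unfolding schur_lambda_def using \<Phi>
      by (intro cInf_greatest) (auto simp: H_injective_sequences_def schur_H_def lambda_bounds_def)
    also have "\<dots> \<le> L \<Phi>"
      unfolding L_def using \<Phi> by (intro cSUP_upper) (auto simp: H_injective_sequences_def)
    finally have "0 \<le> k * L \<Phi>" using k0 by simp
    then have "k * L \<Phi> + e \<in> hyperreflexivity_bounds W"
      using e by (intro mem[OF \<Phi>]) auto
    moreover have "bdd_below (hyperreflexivity_bounds W)"
      by (rule bdd_belowI[of _ 0]) (simp add: hyperreflexivity_bounds_def)
    ultimately show "hyperreflexivity_constant W \<le> k * L \<Phi> + e"
      unfolding hyperreflexivity_constant_def by (rule cInf_lower)
  qed
  \<comment> \<open>Only now is the infimum over all admissible sequences taken, which produces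
    \<open>lambda_H D V\<close>.\<close>
  have "hyperreflexivity_constant W \<le> Inf (L ` H_injective_sequences D V) * k"
    by (rule le_Inf_mult) (use ne k0 bound in \<open>auto simp: mult.commute\<close>)
  then have "hyperreflexivity_constant W \<le> k * lambda_H D V"
    by (simp add: lambda_H_def L_def mult.commute)
  with \<open>hyperreflexive W\<close> show ?thesis
    unfolding W_def k_def by blast
qed

end
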